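(* Let $(X_i)_{i\ge1}$ be i.i.d. random variables with values in $\mathbb R^d$, $d\ge 1$, and suppose that $\Lambda(\lambda)=\log\mathbb E\exp(\langle\lambda,X_1\rangle)$ is finite over a convex open subset $\mathcal D$ of $\mathbb R^d$. Let $(k(n))_{n\ge1}$ be an increasing sequence of positive integers and let $$\Lambda_n^\omega(\lambda)=\frac1n\log\Big(\frac1{k(n)}\sum_{j=1}^{k(n)}\exp\Big(\Big\langle\lambda,\sum_{i=(j-1)n+1}^{jn}X_i(\omega)\Big\rangle\Big)\Big).$$ Let $B$ be a compact subset of $\mathcal D$ and let $\rho>0$ be such that $B_\rho=\{\lambda\in\mathbb R^d:d(\lambda,B)\le\rho\}\subset\mathcal D$. Suppose that there exists a positive sequence $(\epsilon_n)_{n\ge1}$ converging to $0$ such that $$\sum_{n\ge1}\exp\big(-\sqrt{\epsilon_n}[\log(k(n))-n\varLambda^*(B)]\big)\,\epsilon_n^{-(d+1)}\exp\big(\xi_2(B_\rho)\epsilon_nn\big)<\infty.$$ Let $\eta>0$. Then, with probability 1, for $n$ large enough, $$\max_{\lambda\in B}|\Lambda_n^\omega(\lambda)-\Lambda(\lambda)|\le\mathcal E(n,\eta),$$ where $\mathcal E(n,\eta)=(\eta+2\xi_1(B))\epsilon_n$, or $\mathcal E(n,\eta)=\mathcal E(n)=\epsilon_n(1+\epsilon_n)/n$ if $B$ consists of only one point.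
   Context: $\langle\cdot,\cdot\rangle$ is the canonical scalar product on $\mathbb R^d$ and $d(\cdot,\cdot)$ the Euclidean distance. $\Lambda^*(x)=\sup\{\langle\lambda,x\rangle-\Lambda(\lambda):\lambda\in\mathbb R^d\}$. For a subset $B'$ of $\mathcal D$: $\varLambda^*(B')=\sup\{\Lambda^*(\nabla\Lambda(\lambda)):\lambda\in B'\}$; $\xi_1(B')=\sup\{\|\nabla\Lambda(\lambda)\|:\lambda\in B'\}$; $\xi_2(B')=\sup\{\frac12\,{}^t\lambda\,\mathrm D^2\Lambda(\lambda)\,\lambda:\lambda\in B'\}$, where $\mathrm D^2\Lambda(\lambda)$ is the Hessian matrix of $\Lambda$ at $\lambda$. *)

theory Defs
  imports "HOL-Probability.Probability"
begin

text \<open>The logarithmic moment generating function of a random vector, with value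
  \<open>\<infinity>\<close> where the (positive) exponential is not integrable.\<close>

definition log_mgf :: "'w measure \<Rightarrow> ('w \<Rightarrow> real ^ 'n) \<Rightarrow> real ^ 'n \<Rightarrow> ereal" where
  "log_mgf M Y \<theta> =
     (if integrable M (\<lambda>\<omega>. exp (\<theta> \<bullet> Y \<omega>))
      then ereal (ln (integral\<^sup>L M (\<lambda>\<omega>. exp (\<theta> \<bullet> Y \<omega>))))
      else \<infinity>)"

definition legendre :: "(real ^ 'n \<Rightarrow> ereal) \<Rightarrow> real ^ 'n \<Rightarrow> ereal" where
  "legendre f x = (SUP \<theta>. ereal (\<theta> \<bullet> x) - f \<theta>)"

definition gradient :: "(real ^ 'n \<Rightarrow> real) \<Rightarrow> real ^ 'n \<Rightarrow> real ^ 'n" where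
  "gradient f x = (\<chi> i. frechet_derivative f (at x) (axis i 1))"

definition hessian :: "(real ^ 'n \<Rightarrow> real) \<Rightarrow> real ^ 'n \<Rightarrow> real ^ 'n ^ 'n" where
  "hessian f x = jacobian (gradient f) (at x)"

text \<open>In the following, derivatives are taken of \<open>real_of_ereal \<circ> \<Lambda>\<close>; they are meant at interior
  points of the set where \<open>\<Lambda>\<close> is finite. The suprema are extended-valued, so that they
  make sense for every set \<open>B\<close>.\<close>

definition Lambda_star_sup :: "(real ^ 'n \<Rightarrow> ereal) \<Rightarrow> (real ^ 'n) set \<Rightarrow> ereal" where
  "Lambda_star_sup \<Lambda> B = (SUP \<theta>\<in>B. legendre \<Lambda> (gradient (real_of_ereal \<circ> \<Lambda>) \<theta>))"

definition xi1 :: "(real ^ 'n \<Rightarrow> ereal) \<Rightarrow> (real ^ 'n) set \<Rightarrow> ereal" where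
  "xi1 \<Lambda> B = (SUP \<theta>\<in>B. ereal (norm (gradient (real_of_ereal \<circ> \<Lambda>) \<theta>)))"

definition xi2 :: "(real ^ 'n \<Rightarrow> ereal) \<Rightarrow> (real ^ 'n) set \<Rightarrow> ereal" where
  "xi2 \<Lambda> B = (SUP \<theta>\<in>B. ereal (1 / 2 * (\<theta> \<bullet> (hessian (real_of_ereal \<circ> \<Lambda>) \<theta> *v \<theta>))))"

definition emp_log_mgf ::
    "(nat \<Rightarrow> nat) \<Rightarrow> (nat \<Rightarrow> 'w \<Rightarrow> real ^ 'n) \<Rightarrow> nat \<Rightarrow> 'w \<Rightarrow> real ^ 'n \<Rightarrow> real" where
  "emp_log_mgf k X n \<omega> \<theta> =
     1 / real n * ln (1 / real (k n) *
       (\<Sum>j = 1..k n. exp (\<theta> \<bullet> (\<Sum>i = (j - 1) * n + 1..j * n. X i \<omega>))))"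

text \<open>\<open>real_of_ereal\<close> is harmless here: for compact nonempty \<open>B\<close> inside the open domain of
  finiteness of \<open>\<Lambda>\<close>, \<open>xi1 \<Lambda> B\<close> is finite.\<close>

definition error_bound ::
    "(real ^ 'n \<Rightarrow> ereal) \<Rightarrow> (real ^ 'n) set \<Rightarrow> (nat \<Rightarrow> real) \<Rightarrow> nat \<Rightarrow> real \<Rightarrow> real" where
  "error_bound \<Lambda> B \<epsilon> n \<eta> =
     (if is_singleton B then \<epsilon> n * (1 + \<epsilon> n) / real n
      else (\<eta> + 2 * real_of_ereal (xi1 \<Lambda> B)) * \<epsilon> n)"

end

theory Submission
  imports Defs
begin

text \<open>For fixed \<open>\<theta>\<close> the exponentials of the block sums, divided by
\<open>exp (n * \<Lambda> \<theta>)\<close>, are independent, identically distributed and nonnegative with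
mean 1. If \<open>Z\<close> denotes the mean of \<open>k n\<close> of them, then the empirical function differs
from \<open>\<Lambda>\<close> at \<open>\<theta>\<close> by \<open>ln Z / n\<close>, so everything rests on a
law of large numbers with a rate for \<open>Z\<close>. The variance of the exponentials may be infinite, since
\<open>2 * \<theta>\<close> need not lie in \<open>D\<close>; but \<open>(1 + s) * \<theta>\<close> does
for small \<open>s\<close>, so moments of order \<open>1 + s\<close> exist. Truncation followed by Chebyshev's
inequality (\<open>prob_mean_deviation_le\<close>) bounds the probability that \<open>Z\<close> deviates from 1
by more than \<open>e\<close> by a constant times \<open>k powr (- s) * e powr (- (1 + s))\<close>
times the moment of order \<open>1 + s\<close>.

This moment equals
\<open>exp (n * (\<Lambda> ((1 + s) * \<theta>) - (1 + s) * \<Lambda> \<theta>))\<close>. A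
second order Taylor expansion of \<open>\<Lambda>\<close> along the ray through \<open>\<theta>\<close>
(\<open>llmgf_ray_le\<close>) bounds the exponent by \<open>n\<close> times
\<open>s * (\<theta> \<bullet> \<nabla>\<Lambda> \<theta> - \<Lambda> \<theta>) + s\<^sup>2 * xi2\<close>,
and the first bracket is the Legendre transform of \<open>\<Lambda>\<close> at its gradient, because
\<open>\<Lambda>\<close> lies above its tangents (\<open>llmgf_above_tangent\<close>). With
\<open>e = \<epsilon> n\<close> and \<open>s = sqrt (\<epsilon> n)\<close> this is the general term of
the series in the hypothesis, except that \<open>\<epsilon> n\<close> occurs with exponent \<open>- 1\<close>
only: the factor \<open>e powr (- sqrt e)\<close> is bounded.

The remaining factor, \<open>\<epsilon> n\<close> to the power minus the dimension, pays for the number of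
points in a net of \<open>B\<close> of mesh \<open>\<delta> * \<epsilon> n\<close>, and the Borel-Cantelli
lemma gives almost surely \<open>\<bar>Z - 1\<bar> \<le> \<epsilon> n\<close> at all net points for large
\<open>n\<close>. If \<open>B\<close> is a single point, it is its own net, and
\<open>\<bar>ln Z / n\<bar> \<le> \<epsilon> n * (1 + \<epsilon> n) / n\<close> is the assertion.
Otherwise convexity of the empirical function leads from the net to \<open>B\<close>. A convex function that is
bounded above near \<open>B\<close> and bounded below at the net points satisfies a Lipschitz estimate there
(\<open>convex_on_lipschitz_at\<close>). The lower bound is already known. For the upper bound it is enough to
look at finitely many points of \<open>D\<close> whose convex hull contains a neighbourhood of \<open>B\<close>;
at each of them Markov's inequality and the Borel-Cantelli lemma yield a bound for large \<open>n\<close>.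
Choosing \<open>\<delta>\<close> small compared with \<open>\<eta>\<close> and the Lipschitz constants finishes
the proof.

The differential calculus of \<open>\<Lambda>\<close> is obtained by differentiating exponential moments
\<open>E (exp (\<theta> \<bullet> Y) * w)\<close> for all weights \<open>w\<close> of subexponential
growth in \<open>Y\<close> at once (\<open>has_derivative_exp_moment\<close>).\<close>

section \<open>Elementary inequalities\<close>

text \<open>The second order term of \<open>ln (1 - e)\<close> is \<open>- e\<^sup>2 / 2\<close>, so
\<open>e\<^sup>2\<close> leaves room for the higher ones as long as \<open>e\<close> is not too close to 1;
\<open>2/5\<close> is a convenient bound.\<close>

lemma abs_ln_le_of_near_one:
  fixes z e :: real
  assumes "0 < e" "e \<le> 2/5" "\<bar>z - 1\<bar> \<le> e"
  shows "\<bar>ln z\<bar> \<le> e * (1 + e)"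
proof -
  define y where "y = e * (1 + e)"
  have y: "y \<ge> 0" "y \<ge> e" using assms by (auto simp: y_def algebra_simps)
  have z: "z > 0" using assms by auto
  have "ln z \<le> z - 1" using z by (rule ln_le_minus_one)
  hence up: "ln z \<le> y" using y assms by auto
  have q: "2 * e \<le> (1 + e)\<^sup>2 * (1 - e)"
  proof -
    have "(1 + e)\<^sup>2 * (1 - e) - 2 * e = (1 - e) - e\<^sup>2 - e^3"
      by (simp add: power2_eq_square power3_eq_cube algebra_simps)
    moreover have "e\<^sup>2 \<le> (2/5)\<^sup>2" "e^3 \<le> (2/5)^3" using assms by (intro power_mono; simp)+
    ultimately show ?thesis using assms by (simp add: power2_eq_square power3_eq_cube)
  qed
  have "(1 - e) * (1 + y + y\<^sup>2/2) = 1 + e\<^sup>2 / 2 * ((1 + e)\<^sup>2 * (1 - e) - 2 * e)"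
    by (simp add: y_def power2_eq_square field_simps)
  also have "\<dots> \<ge> 1" using q by simp
  finally have "1 \<le> (1 - e) * (1 + y + y\<^sup>2/2)" .
  also have "\<dots> \<le> z * exp y"
    using assms y exp_lower_Taylor_quadratic[of y] by (intro mult_mono) auto
  finally have "1 \<le> z * exp y" .
  hence "0 \<le> ln (z * exp y)" by simp
  also have "\<dots> = ln z + y" using z by (simp add: ln_mult)
  finally show ?thesis using up by (simp add: y_def)
qed

text \<open>Passing from exponent \<open>- 1\<close> to \<open>- (1 + sqrt e)\<close> on the deviation
\<open>e\<close> costs only this constant factor:
\<open>sqrt e * ln (1 / e) = 2 * sqrt e * ln (1 / sqrt e)\<close>, and
\<open>ln y \<le> y\<close>.\<close>

lemma powr_neg_sqrt_le:
  fixes e :: real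
  assumes "0 < e"
  shows "e powr (- sqrt e) \<le> exp 2"
proof -
  have "ln (1 / sqrt e) \<le> 1 / sqrt e" using assms ln_le_minus_one[of "1 / sqrt e"] by simp
  hence "- ln e \<le> 2 / sqrt e" using assms by (simp add: ln_div ln_sqrt)
  hence "sqrt e * (- ln e) \<le> sqrt e * (2 / sqrt e)" using assms by (intro mult_left_mono) auto
  hence "- sqrt e * ln e \<le> 2" using assms by simp
  thus ?thesis using assms by (simp add: powr_def)
qed

lemma abs_exp_minus_linear_le: "\<bar>exp u - 1 - u\<bar> \<le> u\<^sup>2 * exp \<bar>u\<bar>" for u :: real
proof -
  have "\<bar>exp u - 1 - u\<bar> = exp u - (1 + u)" using exp_ge_add_one_self[of u] by linarith
  thus ?thesis using Taylor_exp_field[of u 1] by (simp add: power2_eq_square mult_ac)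
qed

text \<open>The extended suprema of the theorem are read as real numbers, which is only meaningful when they are
finite; an upper bound ensures this, a nonempty index set excludes \<open>- \<infinity>\<close>.\<close>

lemma le_real_of_ereal_SUP:
  fixes f :: "'a \<Rightarrow> real"
  assumes bdd: "\<And>x. x \<in> B \<Longrightarrow> f x \<le> K" and x: "x \<in> B"
  shows "f x \<le> real_of_ereal (SUP x\<in>B. ereal (f x))"
proof -
  have "(SUP x\<in>B. ereal (f x)) \<le> ereal K" using bdd by (auto intro: SUP_least)
  moreover have le: "ereal (f x) \<le> (SUP x\<in>B. ereal (f x))" using x by (rule SUP_upper)
  ultimately obtain s where "(SUP x\<in>B. ereal (f x)) = ereal s"
    by (cases "SUP x\<in>B. ereal (f x)") auto
  thus ?thesis using le by simp
qed

section \<open>Convex functions and finite nets\<close>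

text \<open>Log-convexity of a sum of exponentials is Young's inequality (convexity of \<open>exp\<close>)
applied to each summand after both end points have been normalized to total weight 1; summing the inequalities
gives total weight at most 1 in between.\<close>

lemma convex_on_ln_sum_exp:
  fixes s :: "'j \<Rightarrow> 'a::real_inner"
  assumes "finite J" "J \<noteq> {}" "c > 0"
  shows "convex_on UNIV (\<lambda>\<theta>. ln (c * (\<Sum>j\<in>J. exp (\<theta> \<bullet> s j))))"
proof
  fix t :: real and x y :: 'a
  assume t: "0 < t" "t < 1"
  define G where "G \<theta> = c * (\<Sum>j\<in>J. exp (\<theta> \<bullet> s j))" for \<theta>
  have G: "G \<theta> > 0" for \<theta> using assms by (auto simp: G_def intro!: mult_pos_pos sum_pos)
  define L where "L = (1 - t) * ln (G x) + t * ln (G y)"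
  have expG: "(\<Sum>j\<in>J. c * exp (\<theta> \<bullet> s j - ln (G \<theta>))) = 1" for \<theta>
  proof -
    have "(\<Sum>j\<in>J. c * exp (\<theta> \<bullet> s j - ln (G \<theta>))) = (\<Sum>j\<in>J. c * exp (\<theta> \<bullet> s j)) / G \<theta>"
      using G by (simp add: exp_diff sum_divide_distrib)
    also have "\<dots> = G \<theta> / G \<theta>" by (simp add: G_def sum_distrib_left)
    finally show ?thesis using G[of \<theta>] by simp
  qed
  have "exp (((1 - t) *\<^sub>R x + t *\<^sub>R y) \<bullet> s j - L)
      \<le> (1 - t) * exp (x \<bullet> s j - ln (G x)) + t * exp (y \<bullet> s j - ln (G y))" for j
  proof -
    have "((1 - t) *\<^sub>R x + t *\<^sub>R y) \<bullet> s j - L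
        = (1 - t) *\<^sub>R (x \<bullet> s j - ln (G x)) + t *\<^sub>R (y \<bullet> s j - ln (G y))"
      by (simp add: L_def inner_add_left algebra_simps)
    thus ?thesis using convex_onD[OF exp_convex, of t] t by simp
  qed
  hence "(\<Sum>j\<in>J. c * exp (((1 - t) *\<^sub>R x + t *\<^sub>R y) \<bullet> s j - L))
      \<le> (\<Sum>j\<in>J. c * ((1 - t) * exp (x \<bullet> s j - ln (G x)) + t * exp (y \<bullet> s j - ln (G y))))"
    using assms by (intro sum_mono mult_left_mono) auto
  also have "\<dots> = (1 - t) * (\<Sum>j\<in>J. c * exp (x \<bullet> s j - ln (G x)))
      + t * (\<Sum>j\<in>J. c * exp (y \<bullet> s j - ln (G y)))"
    by (simp only: sum_distrib_left sum.distrib[symmetric] distrib_left mult_ac)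
  also have "\<dots> = 1" by (simp add: expG)
  finally have "G ((1 - t) *\<^sub>R x + t *\<^sub>R y) / exp L \<le> 1"
    by (simp add: G_def exp_diff sum_distrib_left sum_divide_distrib)
  hence "G ((1 - t) *\<^sub>R x + t *\<^sub>R y) \<le> exp L" by (simp add: divide_simps)
  hence "ln (G ((1 - t) *\<^sub>R x + t *\<^sub>R y)) \<le> L"
    using G by (metis ln_exp ln_le_cancel_iff exp_gt_zero)
  thus "ln (c * (\<Sum>j\<in>J. exp (((1 - t) *\<^sub>R x + t *\<^sub>R y) \<bullet> s j)))
     \<le> (1 - t) * ln (c * (\<Sum>j\<in>J. exp (x \<bullet> s j))) + t * ln (c * (\<Sum>j\<in>J. exp (y \<bullet> s j)))"
    by (simp add: L_def G_def)
qed simp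

text \<open>Prolonging the segment between \<open>x\<close> and \<open>y\<close> in both directions to the
points at distance \<open>r\<close> from \<open>x\<close>, convexity compares the slope between \<open>x\<close>
and \<open>y\<close> with the slopes from \<open>x\<close> to the new end points. The upper bound is needed
around both points, the lower bound only at \<open>x\<close>: this is what allows \<open>y\<close> to be an
arbitrary point while \<open>x\<close> belongs to a net.\<close>

lemma convex_on_lipschitz_at:
  fixes f :: "'a::real_normed_vector \<Rightarrow> real"
  assumes f: "convex_on UNIV f" and r: "r > 0"
    and up: "\<And>z. dist x z \<le> r \<or> dist y z \<le> r \<Longrightarrow> f z \<le> M" and lo: "- M \<le> f x"
    and yx: "dist x y \<le> r"
  shows "\<bar>f y - f x\<bar> \<le> 2 * M / r * dist x y"
proof (cases "x = y")
  case False
  define \<tau> where "\<tau> = dist x y"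
  have \<tau>: "0 < \<tau>" "\<tau> \<le> r" "norm (y - x) = \<tau>"
    using False yx by (auto simp: \<tau>_def dist_norm norm_minus_commute)
  \<comment> \<open>The vector \<open>u\<close> has length \<open>r\<close> and points from \<open>x\<close> to
  \<open>y\<close>; beyond \<open>y\<close> the segment ends at \<open>x + u\<close>, beyond \<open>x\<close>
  at \<open>x - u\<close>.\<close>
  define u where "u = (r / \<tau>) *\<^sub>R (y - x)"
  have u: "norm u = r" using \<tau> r by (simp add: u_def)
  have yu: "y = (1 - \<tau> / r) *\<^sub>R x + (\<tau> / r) *\<^sub>R (x + u)"
    using \<tau> r by (simp add: u_def algebra_simps)
  have "f y \<le> (1 - \<tau> / r) * f x + (\<tau> / r) * f (x + u)"
    using convex_onD[OF f, of "\<tau> / r" x "x + u"] \<tau> r yu by auto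
  moreover have fxu: "f (x + u) \<le> M" by (rule up) (simp add: u dist_norm)
  ultimately have "f y - f x \<le> \<tau> / r * (f (x + u) - f x)" by (simp add: algebra_simps)
  also have "\<dots> \<le> \<tau> / r * (2 * M)" using fxu lo \<tau> r by (intro mult_left_mono) auto
  finally have 1: "f y - f x \<le> 2 * M / r * \<tau>" by (simp add: mult_ac)
  define t where "t = \<tau> / (r + \<tau>)"
  have t: "0 \<le> t" "t \<le> 1" "t * (r + \<tau>) = \<tau>" "(1 - t) * (r + \<tau>) = r"
    using \<tau> r by (auto simp: t_def field_simps)
  have "x - ((1 - t) *\<^sub>R y + t *\<^sub>R (x - u)) = ((t * (r + \<tau>)) / \<tau> - 1) *\<^sub>R (y - x)"
    using \<tau> by (simp add: u_def algebra_simps add_divide_distrib)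
  also have "\<dots> = 0" using t \<tau> by simp
  finally have "x = (1 - t) *\<^sub>R y + t *\<^sub>R (x - u)" by simp
  hence "f x \<le> (1 - t) * f y + t * f (x - u)"
    using convex_onD[OF f, of t y "x - u"] t by auto
  hence "(r + \<tau>) * f x \<le> (r + \<tau>) * ((1 - t) * f y + t * f (x - u))"
    using \<tau> r by (intro mult_left_mono) auto
  also have "\<dots> = ((1 - t) * (r + \<tau>)) * f y + (t * (r + \<tau>)) * f (x - u)" by (simp add: algebra_simps)
  finally have "(r + \<tau>) * f x \<le> r * f y + \<tau> * f (x - u)" using t by simp
  hence "r * (f x - f y) \<le> \<tau> * (f (x - u) - f x)" by (simp add: algebra_simps)
  moreover have fxu': "f (x - u) \<le> M" by (rule up) (simp add: u dist_norm)
  ultimately have "r * (f x - f y) \<le> \<tau> * (2 * M)"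
    using lo \<tau> by (smt (verit, best) mult_left_mono)
  hence 2: "f x - f y \<le> 2 * M / r * \<tau>" using r by (simp add: field_simps)
  show ?thesis using 1 2 by (simp add: \<tau>_def)
qed simp

text \<open>Choose one point of \<open>B\<close> in each occupied cell of a cubic grid of side length
\<open>t / d\<close>, \<open>d\<close> being the dimension. The net has to lie inside \<open>B\<close>, as
only there are the moments under control.\<close>

lemma bounded_imp_small_net:
  fixes B :: "(real ^ 'n) set"
  assumes "bounded B"
  shows "\<exists>C>0. \<forall>t. 0 < t \<longrightarrow> t \<le> 1 \<longrightarrow> (\<exists>N. finite N \<and> N \<subseteq> B \<and> (\<forall>x\<in>B. \<exists>y\<in>N. dist x y \<le> t)
       \<and> real (card N) \<le> C * inverse (t ^ CARD('n)))"
proof -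
  obtain R where R: "R > 0" "\<And>x. x \<in> B \<Longrightarrow> norm x \<le> R" using assms unfolding bounded_pos by auto
  define d where "d = real CARD('n)"
  have d: "d \<ge> 1" by (simp add: d_def)
  define C where "C = (2 * R * d + 5) ^ CARD('n)"
  have C: "C > 0" unfolding C_def using R d by (intro zero_less_power) (simp add: add_pos_pos)
  show ?thesis
  proof (intro exI[of _ C] conjI allI impI C)
    fix t :: real assume t: "0 < t" "t \<le> 1"
    \<comment> \<open>Coordinates of points of \<open>B\<close>, measured in units of \<open>t / d\<close>,
    have integer part between \<open>- m\<close> and \<open>m\<close>.\<close>
    define m where "m = nat \<lceil>R * d / t\<rceil> + 1"
    have "R * d / t \<ge> 0" using R d t by auto
    hence K: "int m = \<lceil>R * d / t\<rceil> + 1" by (simp add: m_def)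
    define g where "g x i = \<lfloor>(x $ i) * d / t\<rfloor>" for x :: "real^'n" and i :: 'n
    have gB: "g ` B \<subseteq> (PiE UNIV (\<lambda>_. {- int m..int m}))"
    proof (clarsimp simp: PiE_def)
      fix x i assume x: "x \<in> B"
      have "\<bar>x $ i\<bar> \<le> R" using component_le_norm_cart[of x i] R(2)[OF x] by linarith
      hence "\<bar>x $ i\<bar> * (d / t) \<le> R * (d / t)" using t d by (intro mult_right_mono) auto
      hence a: "\<bar>x $ i * d / t\<bar> \<le> R * d / t" using t d by (simp add: abs_mult)
      show "- int m \<le> g x i \<and> g x i \<le> int m"
        using a K unfolding g_def abs_le_iff by linarith
    qed
    have cP: "card (PiE UNIV (\<lambda>_::'n. {- int m..int m})) = (2 * m + 1) ^ CARD('n)"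
      by (subst card_PiE) (simp_all add: nat_add_distrib nat_mult_distrib algebra_simps)
    have fin: "finite (g ` B)" by (rule finite_subset[OF gB]) (intro finite_PiE; simp)
    define N where "N = (\<lambda>c. SOME x. x \<in> B \<and> g x = c) ` (g ` B)"
    have some: "(SOME y. y \<in> B \<and> g y = g x) \<in> B \<and> g (SOME y. y \<in> B \<and> g y = g x) = g x"
      if "x \<in> B" for x by (rule someI[of "\<lambda>y. y \<in> B \<and> g y = g x" x]) (simp add: that)
    have "finite N" using fin by (simp add: N_def)
    moreover have "N \<subseteq> B" using some by (auto simp: N_def)
    moreover have "\<forall>x\<in>B. \<exists>y\<in>N. dist x y \<le> t"
    proof
      fix x assume x: "x \<in> B"
      define y where "y = (SOME y. y \<in> B \<and> g y = g x)"
      have y: "y \<in> N" "g y = g x" using some[OF x] x by (auto simp: y_def N_def)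
      have "\<bar>(x - y) $ i\<bar> \<le> t / d" for i
      proof -
        have "\<lfloor>(x $ i) * d / t\<rfloor> = \<lfloor>(y $ i) * d / t\<rfloor>" using y(2) by (metis g_def)
        hence "\<bar>(x $ i) * d / t - (y $ i) * d / t\<bar> \<le> 1" by linarith
        moreover have "(x $ i) * d / t - (y $ i) * d / t = (x - y) $ i * (d / t)"
          by (simp add: diff_divide_distrib algebra_simps)
        ultimately have "\<bar>(x - y) $ i\<bar> * (d / t) \<le> 1" using t d by (simp add: abs_mult)
        thus ?thesis using t d by (simp add: field_simps)
      qed
      hence "(\<Sum>i\<in>UNIV. \<bar>(x - y) $ i\<bar>) \<le> (\<Sum>i\<in>(UNIV::'n set). t / d)" by (intro sum_mono) auto
      also have "\<dots> = t" using d by (simp add: d_def)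
      finally have "dist x y \<le> t" unfolding dist_norm by (rule order_trans[OF norm_le_l1_cart])
      thus "\<exists>y\<in>N. dist x y \<le> t" using y by blast
    qed
    moreover have "real (card N) \<le> C * inverse (t ^ CARD('n))"
    proof -
      have "card N \<le> card (g ` B)" unfolding N_def by (rule card_image_le[OF fin])
      also have "\<dots> \<le> (2 * m + 1) ^ CARD('n)"
        unfolding cP[symmetric] by (intro card_mono gB finite_PiE) auto
      finally have "real (card N) \<le> real ((2 * m + 1) ^ CARD('n))" by (simp only: of_nat_le_iff)
      also have "\<dots> = (2 * real m + 1) ^ CARD('n)" by (simp add: add.commute)
      also have "\<dots> \<le> ((2 * R * d + 5) / t) ^ CARD('n)"
      proof (rule power_mono)
        have "real m \<le> R * d / t + 2" using K by linarith
        hence "2 * real m + 1 \<le> 2 * R * d / t + 5" by simp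
        also have "\<dots> \<le> 2 * R * d / t + 5 / t"  using t by (simp add: pos_le_divide_eq)
        also have "\<dots> = (2 * R * d + 5) / t" by (simp add: add_divide_distrib)
        finally show "2 * real m + 1 \<le> (2 * R * d + 5) / t" .
      qed simp
      finally show ?thesis by (simp add: C_def power_divide flip: divide_inverse)
    qed
    ultimately show "\<exists>N. finite N \<and> N \<subseteq> B \<and> (\<forall>x\<in>B. \<exists>y\<in>N. dist x y \<le> t)
       \<and> real (card N) \<le> C * inverse (t ^ CARD('n))" by blast
  qed
qed

text \<open>Cover \<open>B\<close> by finitely many boxes inside \<open>D\<close> and collect their vertices;
the radius is half a Lebesgue number of the cover. On such neighbourhoods the values at the finitely many points
of \<open>F\<close> bound every convex function from above.\<close>

lemma compact_subset_open_imp_finite_hull: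
  fixes B :: "'a::euclidean_space set"
  assumes "compact B" "open D" "B \<subseteq> D"
  obtains F r where "finite F" "F \<subseteq> D" "r > 0" "\<And>x. x \<in> B \<Longrightarrow> cball x r \<subseteq> convex hull F"
proof -
  have "\<forall>x\<in>B. \<exists>U. open U \<and> x \<in> U \<and> (\<exists>F. finite F \<and> F \<subseteq> D \<and> U \<subseteq> convex hull F)"
  proof
    fix x assume "x \<in> B"
    hence "x \<in> D" using assms by blast
    then obtain a b where ab: "cbox a b \<subseteq> D" "x \<in> box a b"
      by (metis open_contains_cbox[OF assms(2)])
    obtain S where S: "finite S" "cbox a b = convex hull S" by (rule closed_interval_as_convex_hull)
    have "S \<subseteq> D" using ab S hull_subset[of S convex] by simp
    thus "\<exists>U. open U \<and> x \<in> U \<and> (\<exists>F. finite F \<and> F \<subseteq> D \<and> U \<subseteq> convex hull F)"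
      using ab S box_subset_cbox[of a b] open_box[of a b] by metis
  qed
  then obtain U where U: "\<And>x. x \<in> B \<Longrightarrow> open (U x) \<and> x \<in> U x" 
      "\<And>x. x \<in> B \<Longrightarrow> \<exists>F. finite F \<and> F \<subseteq> D \<and> U x \<subseteq> convex hull F" by metis
  then obtain F where F: "\<And>x. x \<in> B \<Longrightarrow> finite (F x) \<and> F x \<subseteq> D \<and> U x \<subseteq> convex hull (F x)" by metis
  obtain C where C: "C \<subseteq> B" "finite C" "B \<subseteq> (\<Union>c\<in>C. U c)"
    using compactE_image[OF assms(1), of B U] U by blast
  obtain e where e: "e > 0" "\<And>x. x \<in> B \<Longrightarrow> \<exists>G\<in>U ` C. ball x e \<subseteq> G"
    using Heine_Borel_lemma[OF assms(1), of "U ` C"] C U by blast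
  show ?thesis
  proof (rule that[of "\<Union>c\<in>C. F c" "e / 2"])
    fix x assume "x \<in> B"
    then obtain c where c: "c \<in> C" "ball x e \<subseteq> U c" using e by blast
    have "cball x (e / 2) \<subseteq> ball x e" using e by auto
    also have "\<dots> \<subseteq> convex hull (F c)" using c F C by blast
    also have "\<dots> \<subseteq> convex hull (\<Union>c\<in>C. F c)" using c by (intro hull_mono) auto
    finally show "cball x (e / 2) \<subseteq> convex hull (\<Union>c\<in>C. F c)" .
  qed (use C F e in auto)
qed

section \<open>Deviations of the mean of independent nonnegative variables\<close>

context prob_space
begin

lemma indep_vars_random_variable:
  "indep_vars N X I \<Longrightarrow> i \<in> I \<Longrightarrow> random_variable (N i) (X i)"
  by (auto simp: indep_vars_def)

text \<open>Boundedness makes all integrability questions trivial, and it is the only case that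
occurs after truncation.\<close>

lemma variance_sum_indep:
  fixes W :: "'i \<Rightarrow> 'a \<Rightarrow> real"
  assumes fin: "finite J" and ind: "indep_vars (\<lambda>_. borel) W J"
    and bd: "\<And>i \<omega>. i \<in> J \<Longrightarrow> \<bar>W i \<omega>\<bar> \<le> T"
  shows "variance (\<lambda>\<omega>. \<Sum>i\<in>J. W i \<omega>) = (\<Sum>i\<in>J. variance (W i))"
proof -
  define V where "V i \<omega> = W i \<omega> - expectation (W i)" for i \<omega>
  have mW: "W i \<in> borel_measurable M" if "i \<in> J" for i
    using indep_vars_random_variable[OF ind that] .
  have iW: "integrable M (W i)" if "i \<in> J" for i
    using mW[OF that] bd[OF that] by (intro integrable_const_bound[where B = T]) auto
  have bV: "\<bar>V i \<omega>\<bar> \<le> T + \<bar>expectation (W i)\<bar>" if "i \<in> J" for i \<omega>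
    using bd[OF that, of \<omega>] by (simp add: V_def)
  have mV: "V i \<in> borel_measurable M" if "i \<in> J" for i using mW[OF that] by (simp add: V_def[abs_def])
  have iVV: "integrable M (\<lambda>\<omega>. V i \<omega> * V j \<omega>)" if "i \<in> J" "j \<in> J" for i j
  proof (rule integrable_const_bound[where B = "(T + \<bar>expectation (W i)\<bar>) * (T + \<bar>expectation (W j)\<bar>)"])
    have "\<bar>V i \<omega>\<bar> * \<bar>V j \<omega>\<bar> \<le> (T + \<bar>expectation (W i)\<bar>) * (T + \<bar>expectation (W j)\<bar>)" for \<omega>
      using bV[OF that(1), of \<omega>] bV[OF that(2), of \<omega>] by (intro mult_mono) linarith+
    thus "AE \<omega> in M. norm (V i \<omega> * V j \<omega>) \<le> (T + \<bar>expectation (W i)\<bar>) * (T + \<bar>expectation (W j)\<bar>)"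
      by (simp add: abs_mult)
    show "(\<lambda>\<omega>. V i \<omega> * V j \<omega>) \<in> borel_measurable M" using mV that by simp
  qed
  have eV: "expectation (V i) = 0" if "i \<in> J" for i
    using iW[OF that] by (simp add: V_def[abs_def] prob_space)
  have cross: "expectation (\<lambda>\<omega>. V i \<omega> * V j \<omega>) = 0" if "i \<in> J" "j \<in> J" "i \<noteq> j" for i j
  proof -
    have "indep_vars (\<lambda>_. borel) W {i, j}" by (rule indep_vars_subset[OF ind]) (use that in auto)
    hence iV: "indep_vars (\<lambda>_. borel) V {i, j}"
      unfolding V_def[abs_def] by (rule indep_vars_compose2) simp
    have "expectation (\<lambda>\<omega>. \<Prod>l\<in>{i, j}. V l \<omega>) = (\<Prod>l\<in>{i, j}. expectation (V l))"
      using that iW by (intro indep_vars_lebesgue_integral[OF _ iV]) (auto simp: V_def[abs_def])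
    thus ?thesis using that eV by simp
  qed
  have "variance (\<lambda>\<omega>. \<Sum>i\<in>J. W i \<omega>) = expectation (\<lambda>\<omega>. \<Sum>i\<in>J. \<Sum>j\<in>J. V i \<omega> * V j \<omega>)"
    using iW by (simp add: V_def sum_product power2_eq_square sum_subtractf flip: sum_product)
  also have "\<dots> = (\<Sum>i\<in>J. \<Sum>j\<in>J. expectation (\<lambda>\<omega>. V i \<omega> * V j \<omega>))"
    using iVV by simp
  also have "\<dots> = (\<Sum>i\<in>J. \<Sum>j\<in>J. if j = i then variance (W i) else 0)"
    using cross by (intro sum.cong) (auto simp: V_def power2_eq_square)
  also have "\<dots> = (\<Sum>i\<in>J. variance (W i))" using fin by simp
  finally show ?thesis .
qed

text \<open>A quantitative weak law under a moment of order \<open>p \<in> [1, 2]\<close>. Truncate at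
\<open>T = k * e\<close>, where \<open>k\<close> is the number of variables. All three errors are governed
by the single quantity \<open>Q = k powr (1 - p) * e powr (- p) * m\<close>: some variable exceeds
\<open>T\<close> with probability at most \<open>Q\<close> (Markov), truncation shifts the mean by at most
\<open>e * Q\<close>, and Chebyshev's inequality for the truncated sum contributes \<open>4 * Q\<close>. The
shift is harmless if \<open>Q < 1/2\<close>, and otherwise the claim is trivial.\<close>

lemma prob_mean_deviation_le:
  fixes Y :: "'i \<Rightarrow> 'a \<Rightarrow> real"
  assumes fin: "finite J" and ne: "J \<noteq> {}" and ind: "indep_vars (\<lambda>_. borel) Y J"
    and nonneg: "\<And>i \<omega>. i \<in> J \<Longrightarrow> 0 \<le> Y i \<omega>"
    and int: "\<And>i. i \<in> J \<Longrightarrow> integrable M (Y i)" and mean: "\<And>i. i \<in> J \<Longrightarrow> expectation (Y i) = \<mu>"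
    and intp: "\<And>i. i \<in> J \<Longrightarrow> integrable M (\<lambda>\<omega>. Y i \<omega> powr p)"
    and mom: "\<And>i. i \<in> J \<Longrightarrow> expectation (\<lambda>\<omega>. Y i \<omega> powr p) \<le> m"
    and p: "1 \<le> p" "p \<le> 2" and e: "0 < e"
  shows "prob {\<omega>\<in>space M. \<bar>(\<Sum>i\<in>J. Y i \<omega>) / card J - \<mu>\<bar> > e}
    \<le> 5 * (real (card J) powr (1 - p) * e powr (- p) * m)"
proof -
  define k where "k = real (card J)"
  have k: "k > 0" using fin ne by (simp add: k_def card_gt_0_iff)
  define T where "T = k * e"
  have T: "T > 0" using k e by (simp add: T_def)
  define Q where "Q = k powr (1 - p) * e powr (- p) * m"
  define W where "W i \<omega> = (if Y i \<omega> \<le> T then Y i \<omega> else 0)" for i \<omega>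
  have mY[measurable]: "Y i \<in> borel_measurable M" if "i \<in> J" for i
    using indep_vars_random_variable[OF ind that] .
  have WT: "0 \<le> W i \<omega>" "W i \<omega> \<le> T" "\<bar>W i \<omega>\<bar> \<le> T" if "i \<in> J" for i \<omega>
    using nonneg[OF that, of \<omega>] T by (auto simp: W_def)
  have indW: "indep_vars (\<lambda>_. borel) W J"
    unfolding W_def[abs_def] by (rule indep_vars_compose2[OF ind, of "\<lambda>_ y. if y \<le> T then y else 0"]) simp
  have mW[measurable]: "W i \<in> borel_measurable M" if "i \<in> J" for i
    using indep_vars_random_variable[OF indW that] .
  have iW: "integrable M (W i)" if "i \<in> J" for i
    using mW[OF that] WT(3)[OF that] by (intro integrable_const_bound[where B = T]) auto
  have iW2: "integrable M (\<lambda>\<omega>. (W i \<omega>)\<^sup>2)" if "i \<in> J" for i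
    using mW[OF that] WT[OF that] by (intro integrable_const_bound[where B = "T\<^sup>2"]) (auto intro: power_mono)
  have kT: "k * (T powr (- p) * m) = Q" "T powr (1 - p) * m = e * Q"
       "k * (T powr (2 - p) * m) / (T / 2)\<^sup>2 = 4 * Q"
  proof -
    have [simp]: "k * k powr (- p) = k powr (1 - p)" "e * e powr (- p) = e powr (1 - p)"
      "T * T powr (- p) = T powr (1 - p)" 
      using k e T by (simp_all add: powr_diff powr_minus divide_inverse)
    have Tp: "T powr (- p) = k powr (- p) * e powr (- p)" "T powr (1 - p) = k powr (1 - p) * e powr (1 - p)"
      using k e by (simp_all add: T_def powr_mult)
    show a: "k * (T powr (- p) * m) = Q" using Tp by (simp add: Q_def flip: mult.assoc)
    show "T powr (1 - p) * m = e * Q" unfolding Tp Q_def by (simp add: mult_ac flip: \<open>e * e powr (- p) = e powr (1 - p)\<close>)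
    have "T powr (2 - p) = T\<^sup>2 * T powr (- p)"
      using T by (simp add: powr_diff powr_minus divide_inverse powr_realpow)
    thus "k * (T powr (2 - p) * m) / (T / 2)\<^sup>2 = 4 * Q" using a T by (simp add: power_divide field_simps)
  qed
  have pw: "0 \<le> Y i \<omega> - W i \<omega>" "Y i \<omega> - W i \<omega> \<le> T powr (1 - p) * Y i \<omega> powr p"
      "(W i \<omega>)\<^sup>2 \<le> T powr (2 - p) * Y i \<omega> powr p"
      "indicator {\<omega>\<in>space M. Y i \<omega> > T} \<omega> \<le> T powr (- p) * Y i \<omega> powr p" if "i \<in> J" for i \<omega>
  proof -
    define y where "y = Y i \<omega>"
    have y: "y \<ge> 0" using nonneg[OF that] by (simp add: y_def)
    show "0 \<le> Y i \<omega> - W i \<omega>" using y by (simp add: W_def flip: y_def)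
    have "y \<le> T powr (1 - p) * y powr p" if "y > T"
    proof -
      have "y powr (1 - p) \<le> T powr (1 - p)" using T p that by (intro powr_mono2') auto
      hence "y powr (1 - p) * y powr p \<le> T powr (1 - p) * y powr p" by (intro mult_right_mono) auto
      thus ?thesis using T that by (simp flip: powr_add)
    qed
    thus "Y i \<omega> - W i \<omega> \<le> T powr (1 - p) * Y i \<omega> powr p" by (auto simp: W_def simp flip: y_def)
    have "y\<^sup>2 \<le> T powr (2 - p) * y powr p" if "y \<le> T" "y > 0"
    proof -
      have "y powr (2 - p) \<le> T powr (2 - p)" using p that by (intro powr_mono2) auto
      hence "y powr (2 - p) * y powr p \<le> T powr (2 - p) * y powr p" by (intro mult_right_mono) auto
      thus ?thesis using that by (simp flip: powr_add)
    qed
    thus "(W i \<omega>)\<^sup>2 \<le> T powr (2 - p) * Y i \<omega> powr p" using y by (cases "y = 0") (auto simp: W_def simp flip: y_def)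
    have "1 \<le> T powr (- p) * y powr p" if "y > T"
    proof -
      have "T powr p \<le> y powr p" using T p that by (intro powr_mono2) auto
      thus ?thesis using T by (simp add: powr_minus field_simps)
    qed
    thus "indicator {\<omega>\<in>space M. Y i \<omega> > T} \<omega> \<le> T powr (- p) * Y i \<omega> powr p"
      by (auto simp: indicator_def simp flip: y_def)
  qed
  have Q0: "0 \<le> Q"
  proof -
    obtain i where i: "i \<in> J" using ne by auto
    have "0 \<le> expectation (\<lambda>\<omega>. Y i \<omega> powr p)" by (intro Bochner_Integration.integral_nonneg) auto
    also have "\<dots> \<le> m" by (rule mom[OF i])
    finally show ?thesis by (simp add: Q_def)
  qed
  define A where "A = {\<omega>\<in>space M. \<bar>(\<Sum>i\<in>J. Y i \<omega>) / card J - \<mu>\<bar> > e}"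
  show ?thesis
  proof (cases "Q \<ge> 1/2")
    case True
    have "prob A \<le> 1" by simp
    also have "\<dots> \<le> 5 * Q" using True by simp
    finally show ?thesis by (simp add: A_def Q_def k_def)
  next
    case False
    define E1 where "E1 i = {\<omega>\<in>space M. Y i \<omega> > T}" for i
    define S where "S \<omega> = (\<Sum>i\<in>J. W i \<omega>)" for \<omega>
    define E2 where "E2 = {\<omega>\<in>space M. \<bar>S \<omega> - expectation S\<bar> \<ge> T / 2}"
    have mS[measurable]: "S \<in> borel_measurable M" unfolding S_def[abs_def] by measurable
    have E1M: "E1 i \<in> events" if "i \<in> J" for i unfolding E1_def using mY[OF that] by measurable
    have E2M: "E2 \<in> events" unfolding E2_def by measurable
    have bias: "\<bar>k * \<mu> - expectation S\<bar> \<le> T / 2"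
    proof -
      have "expectation S = (\<Sum>i\<in>J. expectation (W i))" unfolding S_def[abs_def] using iW by simp
      hence "k * \<mu> - expectation S = (\<Sum>i\<in>J. expectation (\<lambda>\<omega>. Y i \<omega> - W i \<omega>))"
        using mean int iW by (simp add: k_def sum_subtractf)
      moreover have "0 \<le> expectation (\<lambda>\<omega>. Y i \<omega> - W i \<omega>)" if "i \<in> J" for i
        using pw that by (intro Bochner_Integration.integral_nonneg) auto
      moreover have "expectation (\<lambda>\<omega>. Y i \<omega> - W i \<omega>) \<le> e / 2" if i: "i \<in> J" for i
      proof -
        have "expectation (\<lambda>\<omega>. Y i \<omega> - W i \<omega>) \<le> expectation (\<lambda>\<omega>. T powr (1 - p) * Y i \<omega> powr p)"
          using pw(2)[OF i] int[OF i] iW[OF i] intp[OF i] by (intro integral_mono) auto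
        also have "\<dots> \<le> T powr (1 - p) * m" using mom[OF i] by (simp add: mult_left_mono)
        also have "\<dots> = e * Q" by (rule kT)
        also have "\<dots> \<le> e / 2" using False e by simp
        finally show ?thesis .
      qed
      moreover from this have "(\<Sum>i\<in>J. expectation (\<lambda>\<omega>. Y i \<omega> - W i \<omega>)) \<le> (\<Sum>i\<in>J. e / 2)"
        by (intro sum_mono)
      ultimately have "0 \<le> k * \<mu> - expectation S" "k * \<mu> - expectation S \<le> (\<Sum>i\<in>J. e / 2)"
        by (simp_all add: sum_nonneg)
      thus ?thesis by (simp add: T_def k_def)
    qed
    have "A \<subseteq> (\<Union>i\<in>J. E1 i) \<union> E2"
    proof (rule ccontr)
      assume "\<not> A \<subseteq> (\<Union>i\<in>J. E1 i) \<union> E2"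
      then obtain \<omega> where \<omega>: "\<omega> \<in> A" "\<And>i. i \<in> J \<Longrightarrow> \<omega> \<notin> E1 i" "\<omega> \<notin> E2" by blast
      have sp: "\<omega> \<in> space M" using \<omega> by (simp add: A_def)
      have "W i \<omega> = Y i \<omega>" if "i \<in> J" for i using \<omega>(2)[OF that] sp by (simp add: E1_def W_def)
      hence "S \<omega> = (\<Sum>i\<in>J. Y i \<omega>)" by (simp add: S_def)
      hence "e < \<bar>S \<omega> / k - \<mu>\<bar>" using \<omega>(1) by (simp add: A_def k_def)
      hence "e * k < \<bar>S \<omega> / k - \<mu>\<bar> * k" using k by simp
      also have "\<dots> = \<bar>(S \<omega> / k - \<mu>) * k\<bar>" using k by (simp add: abs_mult)
      also have "(S \<omega> / k - \<mu>) * k = S \<omega> - k * \<mu>" using k by (simp add: field_simps)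
      finally have "T < \<bar>S \<omega> - k * \<mu>\<bar>" by (simp add: T_def mult.commute)
      moreover have "\<bar>S \<omega> - expectation S\<bar> < T / 2" using \<omega>(3) sp by (simp add: E2_def)
      ultimately show False using bias by linarith
    qed
    hence "prob A \<le> prob ((\<Union>i\<in>J. E1 i) \<union> E2)"
      using E1M E2M fin by (intro finite_measure_mono sets.Un sets.finite_UN) auto
    also have "\<dots> \<le> prob (\<Union>i\<in>J. E1 i) + prob E2"
      using E1M E2M fin by (intro measure_Un_le sets.finite_UN) auto
    also have "prob (\<Union>i\<in>J. E1 i) \<le> (\<Sum>i\<in>J. prob (E1 i))"
      using E1M fin by (intro finite_measure_subadditive_finite) auto
    also have "\<dots> \<le> (\<Sum>i\<in>J. T powr (- p) * m)"
    proof (rule sum_mono)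
      fix i assume i: "i \<in> J"
      have "prob (E1 i) = expectation (indicator (E1 i))" using E1M[OF i] by simp
      also have "\<dots> \<le> expectation (\<lambda>\<omega>. T powr (- p) * Y i \<omega> powr p)"
        using pw(4)[OF i] intp[OF i] E1M[OF i]
        by (intro integral_mono integrable_real_indicator) (auto simp: E1_def emeasure_eq_measure)
      also have "\<dots> \<le> T powr (- p) * m" using mom[OF i] by (simp add: mult_left_mono)
      finally show "prob (E1 i) \<le> T powr (- p) * m" .
    qed
    also have "\<dots> = Q" using kT(1) by (simp add: k_def)
    also have "prob E2 \<le> variance S / (T / 2)\<^sup>2"
      unfolding E2_def
    proof (rule Chebyshev_inequality)
      have "\<bar>S \<omega>\<bar> \<le> k * T" for \<omega>
      proof -
        have "\<bar>S \<omega>\<bar> \<le> (\<Sum>i\<in>J. T)" unfolding S_def using WT by (intro order_trans[OF sum_abs] sum_mono) auto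
        thus ?thesis by (simp add: k_def)
      qed
      hence "\<bar>S \<omega>\<bar>\<^sup>2 \<le> (k * T)\<^sup>2" for \<omega> by (intro power_mono) auto
      thus "integrable M (\<lambda>\<omega>. (S \<omega>)\<^sup>2)" by (intro integrable_const_bound[where B = "(k * T)\<^sup>2"]) auto
    qed (use T in auto)
    also have "variance S = (\<Sum>i\<in>J. variance (W i))"
      unfolding S_def[abs_def] by (rule variance_sum_indep[OF fin indW WT(3)])
    also have "\<dots> \<le> (\<Sum>i\<in>J. T powr (2 - p) * m)"
    proof (rule sum_mono)
      fix i assume i: "i \<in> J"
      have "variance (W i) \<le> expectation (\<lambda>\<omega>. (W i \<omega>)\<^sup>2)"
        using iW[OF i] iW2[OF i] by (simp add: variance_eq)
      also have "\<dots> \<le> expectation (\<lambda>\<omega>. T powr (2 - p) * Y i \<omega> powr p)"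
        using pw(3)[OF i] iW2[OF i] intp[OF i] by (intro integral_mono) auto
      also have "\<dots> \<le> T powr (2 - p) * m" using mom[OF i] by (simp add: mult_left_mono)
      finally show "variance (W i) \<le> T powr (2 - p) * m" .
    qed
    finally have "prob A \<le> Q + k * (T powr (2 - p) * m) / (T / 2)\<^sup>2"
      using T by (simp add: k_def divide_right_mono)
    also have "\<dots> = 5 * Q" using kT(3) by simp
    finally show ?thesis by (simp add: A_def Q_def k_def)
  qed
qed

end

section \<open>Exponential moments\<close>

lemma has_derivative_quadratic_remainder:
  fixes f :: "'a::real_normed_vector \<Rightarrow> 'b::real_normed_vector"
  assumes "bounded_linear A" "r > 0"
    and "\<And>h. norm h \<le> r \<Longrightarrow> norm (f (x + h) - f x - A h) \<le> K * (norm h)\<^sup>2"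
  shows "(f has_derivative A) (at x)"
  unfolding has_derivative_at
proof (intro conjI assms(1))
  show "(\<lambda>h. norm (f (x + h) - f x - A h) / norm h) \<midarrow>0\<rightarrow> 0"
  proof (rule Lim_null_comparison)
    have "\<forall>\<^sub>F h in at 0. norm (h::'a) < r" using assms(2)
      by (auto simp: eventually_at intro!: exI[of _ r])
    moreover have "\<forall>\<^sub>F h in at 0. h \<noteq> (0::'a)" by (auto simp: eventually_at intro!: exI[of _ 1])
    ultimately show "\<forall>\<^sub>F h in at 0. norm (norm (f (x + h) - f x - A h) / norm h) \<le> K * norm h"
    proof eventually_elim
      case (elim h)
      thus ?case using assms(3)[of h] by (simp add: divide_le_eq power2_eq_square mult_ac)
    qed
    have "((\<lambda>h::'a. K * norm h) \<longlongrightarrow> K * norm (0::'a)) (at 0)" by (intro tendsto_intros)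
    thus "((\<lambda>h::'a. K * norm h) \<longlongrightarrow> 0) (at 0)" by simp
  qed
qed

lemma gradient_unique:
  fixes f :: "real ^ 'n \<Rightarrow> real"
  assumes "(f has_derivative (\<lambda>h. h \<bullet> g)) (at x)"
  shows "gradient f x = g"
  using frechet_derivative_at[OF assms]
  by (simp add: gradient_def vec_eq_iff inner_axis' flip: frechet_derivative_at[OF assms])

locale exponential_moments = prob_space M for M :: "'w measure" +
  fixes Y :: "'w \<Rightarrow> real ^ 'n" and D :: "(real ^ 'n) set"
  assumes Y_measurable[measurable]: "Y \<in> borel_measurable M"
    and open_D: "open D"
    and integrable_exp: "\<theta> \<in> D \<Longrightarrow> integrable M (\<lambda>\<omega>. exp (\<theta> \<bullet> Y \<omega>))"
begin

text \<open>The exponential moments exist on a whole neighbourhood of \<open>\<theta>\<close>, hence at finitely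
many points whose convex hull contains a ball of some radius \<open>r\<close> around \<open>\<theta>\<close>.
The exponent \<open>\<theta> \<bullet> y + r * norm y\<close> is the value of the linear function
\<open>v \<mapsto> v \<bullet> y\<close> at a point of that ball, so it is dominated by one of its values at
those finitely many points.\<close>

lemma integrable_exp_norm:
  assumes "\<theta> \<in> D"
  obtains r where "r > 0" "integrable M (\<lambda>\<omega>. exp (\<theta> \<bullet> Y \<omega> + r * norm (Y \<omega>)))"
proof -
  obtain F r where F: "finite F" "F \<subseteq> D" "r > 0" "\<And>x. x \<in> {\<theta>} \<Longrightarrow> cball x r \<subseteq> convex hull F"
    using compact_subset_open_imp_finite_hull[of "{\<theta>}" D] assms open_D
    by (metis compact_sing empty_subsetI insert_subset)
  have "F \<noteq> {}" using F(3) F(4)[of \<theta>] by auto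
  have *: "exp (\<theta> \<bullet> y + r * norm y) \<le> (\<Sum>v\<in>F. exp (v \<bullet> y))" for y :: "real ^ 'n"
  proof -
    have pos: "(\<Sum>v\<in>F. exp (v \<bullet> y)) > 0" using F(1) \<open>F \<noteq> {}\<close> by (intro sum_pos) auto
    have "\<forall>v\<in>F. v \<bullet> y \<le> ln (\<Sum>v\<in>F. exp (v \<bullet> y))"
    proof
      fix v assume "v \<in> F"
      hence "exp (v \<bullet> y) \<le> (\<Sum>v\<in>F. exp (v \<bullet> y))"
        using member_le_sum[of v F "\<lambda>v. exp (v \<bullet> y)"] F(1) by simp
      thus "v \<bullet> y \<le> ln (\<Sum>v\<in>F. exp (v \<bullet> y))" using pos by (simp add: ln_ge_iff)
    qed
    moreover have "convex_on (convex hull F) (\<lambda>v. v \<bullet> y)"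
      by (auto simp: convex_on_def convex_convex_hull inner_add_left)
    ultimately have "\<forall>v\<in>convex hull F. v \<bullet> y \<le> ln (\<Sum>v\<in>F. exp (v \<bullet> y))"
      by (intro convex_on_convex_hull_bound)
    \<comment> \<open>The point of the ball at which \<open>v \<bullet> y\<close> is largest.\<close>
    moreover have "\<theta> + r *\<^sub>R sgn y \<in> convex hull F"
      using F(3) F(4)[of \<theta>] by (auto simp: dist_norm norm_sgn subset_iff)
    ultimately have "(\<theta> + r *\<^sub>R sgn y) \<bullet> y \<le> ln (\<Sum>v\<in>F. exp (v \<bullet> y))" by blast
    moreover have "sgn y \<bullet> y = norm y"
      by (cases "y = 0") (simp_all add: sgn_div_norm dot_square_norm power2_eq_square)
    ultimately show ?thesis using pos by (simp add: inner_add_left ln_ge_iff)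
  qed
  have "integrable M (\<lambda>\<omega>. exp (\<theta> \<bullet> Y \<omega> + r * norm (Y \<omega>)))"
  proof (rule Bochner_Integration.integrable_bound)
    show "integrable M (\<lambda>\<omega>. \<Sum>v\<in>F. exp (v \<bullet> Y \<omega>))"
      using F(2) integrable_exp by (intro Bochner_Integration.integrable_sum) auto
    show "AE \<omega> in M. norm (exp (\<theta> \<bullet> Y \<omega> + r * norm (Y \<omega>))) \<le> norm (\<Sum>v\<in>F. exp (v \<bullet> Y \<omega>))"
      using * by (intro AE_I2) (auto intro: order_trans[OF _ abs_ge_self])
  qed measurable
  thus ?thesis using F(3) that by blast
qed

text \<open>The weights that occur are polynomials in \<open>Y\<close>. Requiring growth slower than every
\<open>exp (r * norm Y)\<close> covers them, is stable under products, and is what local exponential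
integrability can absorb.\<close>

definition subexponential :: "('w \<Rightarrow> 'b::euclidean_space) \<Rightarrow> bool" where
  "subexponential w \<longleftrightarrow> w \<in> borel_measurable M \<and>
     (\<forall>r>0. \<exists>C. \<forall>\<omega>. norm (w \<omega>) \<le> C * exp (r * norm (Y \<omega>)))"

lemma subexponential_const: "subexponential (\<lambda>_. c)"
  unfolding subexponential_def
proof (intro conjI allI impI)
  fix r :: real assume r: "r > 0"
  have "norm c * 1 \<le> norm c * exp (r * norm (Y \<omega>))" for \<omega>
    using r by (intro mult_left_mono) auto
  thus "\<exists>C. \<forall>\<omega>. norm c \<le> C * exp (r * norm (Y \<omega>))" by auto
qed simp

lemma subexponential_Y: "subexponential Y"
  unfolding subexponential_def
proof (intro conjI allI impI)
  fix r :: real assume r: "r > 0"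
  have "norm (Y \<omega>) \<le> 1 / r * exp (r * norm (Y \<omega>))" for \<omega>
  proof -
    have "r * norm (Y \<omega>) \<le> exp (r * norm (Y \<omega>))"
      using exp_ge_add_one_self[of "r * norm (Y \<omega>)"] by linarith
    thus ?thesis using r by (simp add: pos_le_divide_eq mult.commute)
  qed
  thus "\<exists>C. \<forall>\<omega>. norm (Y \<omega>) \<le> C * exp (r * norm (Y \<omega>))" by blast
qed measurable

lemma subexponential_scaleR:
  assumes "subexponential f" "subexponential g"
  shows "subexponential (\<lambda>\<omega>. f \<omega> *\<^sub>R g \<omega>)"
  unfolding subexponential_def
proof (intro conjI allI impI)
  fix r :: real assume r: "r > 0"
  obtain C1 where 1: "\<And>\<omega>. norm (f \<omega>) \<le> C1 * exp (r/2 * norm (Y \<omega>))"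
    using assms(1) r unfolding subexponential_def by (meson half_gt_zero)
  obtain C2 where 2: "\<And>\<omega>. norm (g \<omega>) \<le> C2 * exp (r/2 * norm (Y \<omega>))"
    using assms(2) r unfolding subexponential_def by (meson half_gt_zero)
  have "norm (f \<omega> *\<^sub>R g \<omega>) \<le> (C1 * C2) * exp (r * norm (Y \<omega>))" for \<omega>
  proof -
    have "norm (f \<omega> *\<^sub>R g \<omega>) = norm (f \<omega>) * norm (g \<omega>)" by simp
    also have "\<dots> \<le> (C1 * exp (r/2 * norm (Y \<omega>))) * (C2 * exp (r/2 * norm (Y \<omega>)))"
      using 1[of \<omega>] 2[of \<omega>] order_trans[OF norm_ge_zero 1[of \<omega>]] by (intro mult_mono) auto
    also have "\<dots> = (C1 * C2) * exp (r/2 * norm (Y \<omega>) + r/2 * norm (Y \<omega>))"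
      unfolding exp_add by (simp add: mult_ac)
    also have "r/2 * norm (Y \<omega>) + r/2 * norm (Y \<omega>) = r * norm (Y \<omega>)" by simp
    finally show ?thesis .
  qed
  thus "\<exists>C. \<forall>\<omega>. norm (f \<omega> *\<^sub>R g \<omega>) \<le> C * exp (r * norm (Y \<omega>))" by blast
qed (use assms in \<open>auto simp: subexponential_def\<close>)

lemma subexponential_norm: "subexponential w \<Longrightarrow> subexponential (\<lambda>\<omega>. norm (w \<omega>))"
  unfolding subexponential_def by auto

lemma subexponential_inner:
  assumes "subexponential w" shows "subexponential (\<lambda>\<omega>. h \<bullet> w \<omega>)"
  unfolding subexponential_def
proof (intro conjI allI impI)
  fix r :: real assume "r > 0"
  then obtain C where "\<And>\<omega>. norm (w \<omega>) \<le> C * exp (r * norm (Y \<omega>))"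
    using assms unfolding subexponential_def by meson
  hence "norm h * norm (w \<omega>) \<le> norm h * (C * exp (r * norm (Y \<omega>)))" for \<omega>
    by (intro mult_left_mono) auto
  hence "norm (h \<bullet> w \<omega>) \<le> (norm h * C) * exp (r * norm (Y \<omega>))" for \<omega>
    using Cauchy_Schwarz_ineq2[of h "w \<omega>"] by (auto simp: mult.assoc intro: order_trans)
  thus "\<exists>C. \<forall>\<omega>. norm (h \<bullet> w \<omega>) \<le> C * exp (r * norm (Y \<omega>))" by blast
qed (use assms in \<open>auto simp: subexponential_def\<close>)

lemmas subexponential_intros = subexponential_const subexponential_Y subexponential_scaleR
  subexponential_norm subexponential_inner

text \<open>Half of the extra exponential integrability absorbs a subexponential weight; the other
half is available to dominate difference quotients.\<close>

lemma integrable_exp_norm_dominated: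
  fixes v :: "'w \<Rightarrow> 'b::euclidean_space" and w :: "'w \<Rightarrow> 'c::euclidean_space"
  assumes r: "r > 0" "integrable M (\<lambda>\<omega>. exp (\<theta> \<bullet> Y \<omega> + r * norm (Y \<omega>)))"
    and v[measurable]: "v \<in> borel_measurable M" and w: "subexponential w"
    and vw: "\<And>\<omega>. norm (v \<omega>) \<le> exp (\<theta> \<bullet> Y \<omega> + r/2 * norm (Y \<omega>)) * norm (w \<omega>)"
  shows "integrable M v"
proof -
  obtain C where C: "\<And>\<omega>. norm (w \<omega>) \<le> C * exp (r/2 * norm (Y \<omega>))"
    using w r(1) unfolding subexponential_def by (meson half_gt_zero)
  show ?thesis
  proof (rule Bochner_Integration.integrable_bound)
    show "integrable M (\<lambda>\<omega>. C * exp (\<theta> \<bullet> Y \<omega> + r * norm (Y \<omega>)))" using r(2) by simp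
    show "AE \<omega> in M. norm (v \<omega>) \<le> norm (C * exp (\<theta> \<bullet> Y \<omega> + r * norm (Y \<omega>)))"
    proof (rule AE_I2)
      fix \<omega>
      note vw[of \<omega>]
      also have "exp (\<theta> \<bullet> Y \<omega> + r/2 * norm (Y \<omega>)) * norm (w \<omega>)
        \<le> exp (\<theta> \<bullet> Y \<omega> + r/2 * norm (Y \<omega>)) * (C * exp (r/2 * norm (Y \<omega>)))"
        using C by (intro mult_left_mono) auto
      also have "\<dots> = C * exp ((\<theta> \<bullet> Y \<omega> + r/2 * norm (Y \<omega>)) + r/2 * norm (Y \<omega>))"
        unfolding exp_add by (simp add: mult_ac)
      also have "\<dots> = C * exp (\<theta> \<bullet> Y \<omega> + r * norm (Y \<omega>))" by (simp add: algebra_simps)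
      also have "\<dots> \<le> norm \<dots>" by simp
      finally show "norm (v \<omega>) \<le> norm (C * exp (\<theta> \<bullet> Y \<omega> + r * norm (Y \<omega>)))" .
    qed
  qed measurable
qed

definition exp_moment :: "('w \<Rightarrow> 'b::euclidean_space) \<Rightarrow> real ^ 'n \<Rightarrow> 'b" where
  "exp_moment w \<theta> = expectation (\<lambda>\<omega>. exp (\<theta> \<bullet> Y \<omega>) *\<^sub>R w \<omega>)"

lemma integrable_exp_moment:
  fixes w :: "'w \<Rightarrow> 'b::euclidean_space"
  assumes "subexponential w" "\<theta> \<in> D"
  shows "integrable M (\<lambda>\<omega>. exp (\<theta> \<bullet> Y \<omega>) *\<^sub>R w \<omega>)"
proof -
  obtain r where r: "r > 0" "integrable M (\<lambda>\<omega>. exp (\<theta> \<bullet> Y \<omega> + r * norm (Y \<omega>)))"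
    using integrable_exp_norm[OF assms(2)] .
  have [measurable]: "w \<in> borel_measurable M" using assms(1) by (simp add: subexponential_def)
  show ?thesis
    by (rule integrable_exp_norm_dominated[OF r _ assms(1)]) (use r(1) in \<open>auto intro!: mult_right_mono\<close>)
qed

text \<open>Differentiation under the expectation. The first order Taylor remainder of the exponential is at
most \<open>(norm h)\<^sup>2\<close> times a function that is integrable by the local exponential integrability
of \<open>norm Y\<close>, uniformly in small \<open>h\<close>.\<close>

lemma has_derivative_exp_moment:
  fixes w :: "'w \<Rightarrow> 'b::euclidean_space"
  assumes w: "subexponential w" and \<theta>: "\<theta> \<in> D"
  shows "(exp_moment w has_derivative (\<lambda>h. exp_moment (\<lambda>\<omega>. (h \<bullet> Y \<omega>) *\<^sub>R w \<omega>) \<theta>)) (at \<theta>)"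
proof -
  define A where "A h = exp_moment (\<lambda>\<omega>. (h \<bullet> Y \<omega>) *\<^sub>R w \<omega>) \<theta>" for h
  have ih: "integrable M (\<lambda>\<omega>. exp (\<theta> \<bullet> Y \<omega>) *\<^sub>R ((h \<bullet> Y \<omega>) *\<^sub>R w \<omega>))" for h
    by (intro integrable_exp_moment \<theta> subexponential_intros w)
  have "linear A"
  proof (rule linearI)
    fix h1 h2 :: "real ^ 'n"
    have "A (h1 + h2) = expectation (\<lambda>\<omega>. exp (\<theta> \<bullet> Y \<omega>) *\<^sub>R ((h1 \<bullet> Y \<omega>) *\<^sub>R w \<omega>)
                                     + exp (\<theta> \<bullet> Y \<omega>) *\<^sub>R ((h2 \<bullet> Y \<omega>) *\<^sub>R w \<omega>))"
      unfolding A_def exp_moment_def by (simp only: inner_add_left scaleR_add_left scaleR_add_right)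
    also have "\<dots> = A h1 + A h2"
      unfolding A_def exp_moment_def by (rule Bochner_Integration.integral_add[OF ih ih])
    finally show "A (h1 + h2) = A h1 + A h2" .
  next
    fix c :: real and h :: "real ^ 'n"
    have "A (c *\<^sub>R h) = expectation (\<lambda>\<omega>. c *\<^sub>R (exp (\<theta> \<bullet> Y \<omega>) *\<^sub>R ((h \<bullet> Y \<omega>) *\<^sub>R w \<omega>)))"
      unfolding A_def exp_moment_def by (simp add: mult_ac)
    also have "\<dots> = c *\<^sub>R A h" unfolding A_def exp_moment_def by (rule integral_scaleR_right)
    finally show "A (c *\<^sub>R h) = c *\<^sub>R A h" .
  qed
  hence bl: "bounded_linear A" by (simp add: linear_conv_bounded_linear)
  have [measurable]: "w \<in> borel_measurable M" using w by (simp add: subexponential_def)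
  obtain r0 where r0: "r0 > 0" "integrable M (\<lambda>\<omega>. exp (\<theta> \<bullet> Y \<omega> + r0 * norm (Y \<omega>)))"
    using integrable_exp_norm[OF \<theta>] .
  define r where "r = r0 / 2"
  have r: "r > 0" using r0 by (simp add: r_def)
  \<comment> \<open>The dominating function for the remainder, without the factor
  \<open>(norm h)\<^sup>2\<close>.\<close>
  define g where "g \<omega> = exp (\<theta> \<bullet> Y \<omega> + r * norm (Y \<omega>)) *\<^sub>R (norm (Y \<omega>) *\<^sub>R (norm (Y \<omega>) *\<^sub>R norm (w \<omega>)))" for \<omega>
  have [measurable]: "g \<in> borel_measurable M" unfolding g_def[abs_def] by measurable
  have ig: "integrable M g"
  proof (rule integrable_exp_norm_dominated[OF r0])
    show "subexponential (\<lambda>\<omega>. norm (Y \<omega>) *\<^sub>R (norm (Y \<omega>) *\<^sub>R norm (w \<omega>)))"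
      by (intro subexponential_intros w)
  qed (simp_all add: g_def r_def abs_mult)
  have "(exp_moment w has_derivative A) (at \<theta>)"
  proof (rule has_derivative_quadratic_remainder[OF bl r])
    fix h :: "real ^ 'n" assume h: "norm h \<le> r"
    define R where "R \<omega> = exp ((\<theta> + h) \<bullet> Y \<omega>) *\<^sub>R w \<omega> - exp (\<theta> \<bullet> Y \<omega>) *\<^sub>R w \<omega>
            - exp (\<theta> \<bullet> Y \<omega>) *\<^sub>R ((h \<bullet> Y \<omega>) *\<^sub>R w \<omega>)" for \<omega>
    have i1: "integrable M (\<lambda>\<omega>. exp ((\<theta> + h) \<bullet> Y \<omega>) *\<^sub>R w \<omega>)"
    proof (rule integrable_exp_norm_dominated[OF r0 _ w])
      fix \<omega>
      have "h \<bullet> Y \<omega> \<le> r * norm (Y \<omega>)"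
        using Cauchy_Schwarz_ineq2[of h "Y \<omega>"] mult_right_mono[OF h, of "norm (Y \<omega>)"] by auto
      thus "norm (exp ((\<theta> + h) \<bullet> Y \<omega>) *\<^sub>R w \<omega>) \<le> exp (\<theta> \<bullet> Y \<omega> + r0 / 2 * norm (Y \<omega>)) * norm (w \<omega>)"
        by (simp add: inner_add_left r_def mult_right_mono)
    qed measurable
    have i2: "integrable M (\<lambda>\<omega>. exp (\<theta> \<bullet> Y \<omega>) *\<^sub>R w \<omega>)" by (rule integrable_exp_moment[OF w \<theta>])
    have iR: "integrable M R" unfolding R_def[abs_def] using i1 i2 ih by simp
    have "exp_moment w (\<theta> + h) - exp_moment w \<theta> - A h = expectation R"
      unfolding R_def[abs_def] A_def exp_moment_def using i1 i2 ih by simp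
    moreover have "norm (expectation R) \<le> expectation (\<lambda>\<omega>. (norm h)\<^sup>2 * g \<omega>)"
    proof (rule order_trans[OF integral_norm_bound integral_mono])
      fix \<omega>
      define u where "u = h \<bullet> Y \<omega>"
      have u: "\<bar>u\<bar> \<le> norm h * norm (Y \<omega>)" unfolding u_def by (rule Cauchy_Schwarz_ineq2)
      have ur: "\<bar>u\<bar> \<le> r * norm (Y \<omega>)" using u mult_right_mono[OF h, of "norm (Y \<omega>)"] by auto
      have "R \<omega> = (exp (\<theta> \<bullet> Y \<omega>) * (exp u - 1 - u)) *\<^sub>R w \<omega>"
        by (simp add: R_def u_def inner_add_left exp_add algebra_simps)
      hence "norm (R \<omega>) = exp (\<theta> \<bullet> Y \<omega>) * \<bar>exp u - 1 - u\<bar> * norm (w \<omega>)" by (simp add: abs_mult)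
      also have "\<dots> \<le> exp (\<theta> \<bullet> Y \<omega>) * ((norm h * norm (Y \<omega>))\<^sup>2 * exp (r * norm (Y \<omega>))) * norm (w \<omega>)"
      proof (intro mult_right_mono mult_left_mono)
        have "\<bar>exp u - 1 - u\<bar> \<le> \<bar>u\<bar>\<^sup>2 * exp \<bar>u\<bar>" using abs_exp_minus_linear_le[of u] by simp
        also have "\<dots> \<le> (norm h * norm (Y \<omega>))\<^sup>2 * exp (r * norm (Y \<omega>))"
          using u ur by (intro mult_mono power_mono) auto
        finally show "\<bar>exp u - 1 - u\<bar> \<le> (norm h * norm (Y \<omega>))\<^sup>2 * exp (r * norm (Y \<omega>))" .
      qed auto
      also have "\<dots> = (norm h)\<^sup>2 * g \<omega>"
        by (simp add: g_def exp_add power2_eq_square mult_ac)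
      finally show "norm (R \<omega>) \<le> (norm h)\<^sup>2 * g \<omega>" .
    qed (use iR ig in auto)
    ultimately show "norm (exp_moment w (\<theta> + h) - exp_moment w \<theta> - A h) \<le> expectation g * (norm h)\<^sup>2"
      by (simp add: mult.commute)
  qed
  thus ?thesis by (simp add: A_def[abs_def])
qed

lemma continuous_on_exp_moment:
  "subexponential w \<Longrightarrow> continuous_on D (exp_moment w)"
  using has_derivative_exp_moment has_derivative_at_withinI
  by (meson has_derivative_continuous_on)

section \<open>The logarithmic moment generating function\<close>

abbreviation llmgf :: "real ^ 'n \<Rightarrow> real" where
  "llmgf \<equiv> real_of_ereal \<circ> log_mgf M Y"

abbreviation mgf :: "real ^ 'n \<Rightarrow> real" where
  "mgf \<equiv> exp_moment (\<lambda>_. 1)"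

text \<open>The mean of \<open>Y\<close> under the measure with density proportional to
\<open>exp (\<theta> \<bullet> Y)\<close>.\<close>

abbreviation tilted_mean :: "real ^ 'n \<Rightarrow> real ^ 'n" where
  "tilted_mean \<theta> \<equiv> exp_moment Y \<theta> /\<^sub>R mgf \<theta>"

lemma mgf_eq: "mgf \<theta> = expectation (\<lambda>\<omega>. exp (\<theta> \<bullet> Y \<omega>))"
  by (simp add: exp_moment_def)

lemma expectation_exp_pos:
  assumes "integrable M (\<lambda>\<omega>. exp (\<theta> \<bullet> Y \<omega>))"
  shows "0 < expectation (\<lambda>\<omega>. exp (\<theta> \<bullet> Y \<omega>))"
proof -
  have "0 \<le> expectation (\<lambda>\<omega>. exp (\<theta> \<bullet> Y \<omega>))" by (intro Bochner_Integration.integral_nonneg) auto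
  moreover have "expectation (\<lambda>\<omega>. exp (\<theta> \<bullet> Y \<omega>)) \<noteq> 0"
  proof
    assume "expectation (\<lambda>\<omega>. exp (\<theta> \<bullet> Y \<omega>)) = 0"
    hence "AE \<omega> in M. exp (\<theta> \<bullet> Y \<omega>) = 0"
      using integral_nonneg_eq_0_iff_AE[OF assms] by simp
    hence "AE \<omega> in M. False" by simp
    thus False using AE_False by auto
  qed
  ultimately show ?thesis by linarith
qed

lemma mgf_pos: "\<theta> \<in> D \<Longrightarrow> mgf \<theta> > 0"
  unfolding mgf_eq by (intro expectation_exp_pos integrable_exp)

lemma log_mgf_eq: "\<theta> \<in> D \<Longrightarrow> log_mgf M Y \<theta> = ereal (ln (mgf \<theta>))"
  by (simp add: log_mgf_def integrable_exp mgf_eq)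

lemma llmgf_eq: "\<theta> \<in> D \<Longrightarrow> llmgf \<theta> = ln (mgf \<theta>)"
  by (simp add: log_mgf_eq)

lemma exp_moment_inner: 
  assumes "subexponential w" "\<theta> \<in> D"
  shows "exp_moment (\<lambda>\<omega>. h \<bullet> w \<omega>) \<theta> = h \<bullet> exp_moment w \<theta>"
proof -
  have "exp_moment (\<lambda>\<omega>. h \<bullet> w \<omega>) \<theta> = expectation (\<lambda>\<omega>. h \<bullet> (exp (\<theta> \<bullet> Y \<omega>) *\<^sub>R w \<omega>))"
    by (simp add: exp_moment_def)
  also have "\<dots> = h \<bullet> exp_moment w \<theta>"
    unfolding exp_moment_def by (rule integral_inner_right) (rule integrable_exp_moment[OF assms])
  finally show ?thesis .
qed

lemma has_derivative_mgf:
  assumes "\<theta> \<in> D"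
  shows "(mgf has_derivative (\<lambda>h. h \<bullet> exp_moment Y \<theta>)) (at \<theta>)"
  using has_derivative_exp_moment[OF subexponential_const[of "1::real"] assms]
    exp_moment_inner[OF subexponential_Y assms] by simp

lemma has_derivative_llmgf_tilted_mean:
  assumes "\<theta> \<in> D"
  shows "(llmgf has_derivative (\<lambda>h. h \<bullet> tilted_mean \<theta>)) (at \<theta>)"
proof -
  have "((\<lambda>\<theta>. ln (mgf \<theta>)) has_derivative (\<lambda>h. h \<bullet> tilted_mean \<theta>)) (at \<theta>)"
    using has_derivative_mgf[OF assms] mgf_pos[OF assms]
    by (auto intro!: derivative_eq_intros simp: divide_inverse)
  thus ?thesis
    by (rule has_derivative_transform_within_open[OF _ open_D assms]) (simp add: log_mgf_eq)
qed

lemma gradient_llmgf: "\<theta> \<in> D \<Longrightarrow> gradient llmgf \<theta> = tilted_mean \<theta>"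
  by (rule gradient_unique[OF has_derivative_llmgf_tilted_mean])

lemma has_derivative_llmgf:
  "\<theta> \<in> D \<Longrightarrow> (llmgf has_derivative (\<lambda>h. h \<bullet> gradient llmgf \<theta>)) (at \<theta>)"
  using has_derivative_llmgf_tilted_mean gradient_llmgf by simp

lemma has_derivative_gradient_llmgf_covariance:
  assumes "\<theta> \<in> D"
  shows "(gradient llmgf has_derivative (\<lambda>h. exp_moment (\<lambda>\<omega>. (h \<bullet> Y \<omega>) *\<^sub>R Y \<omega>) \<theta> /\<^sub>R mgf \<theta>
            - (h \<bullet> tilted_mean \<theta>) *\<^sub>R tilted_mean \<theta>)) (at \<theta>)"
proof -
  have "((\<lambda>\<theta>. tilted_mean \<theta>) has_derivative (\<lambda>h. exp_moment (\<lambda>\<omega>. (h \<bullet> Y \<omega>) *\<^sub>R Y \<omega>) \<theta> /\<^sub>R mgf \<theta>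
            - (h \<bullet> tilted_mean \<theta>) *\<^sub>R tilted_mean \<theta>)) (at \<theta>)"
    using has_derivative_mgf[OF assms] has_derivative_exp_moment[OF subexponential_Y assms] mgf_pos[OF assms]
    by (auto intro!: derivative_eq_intros ext simp: algebra_simps)
  thus ?thesis
    by (rule has_derivative_transform_within_open[OF _ open_D assms]) (simp add: gradient_llmgf)
qed

text \<open>The covariance matrix of \<open>Y\<close> under the measure tilted by
\<open>exp (\<theta> \<bullet> Y)\<close>.\<close>

lemma hessian_llmgf:
  assumes "\<theta> \<in> D"
  shows "hessian llmgf \<theta> *v h = exp_moment (\<lambda>\<omega>. (h \<bullet> Y \<omega>) *\<^sub>R Y \<omega>) \<theta> /\<^sub>R mgf \<theta>
            - (h \<bullet> tilted_mean \<theta>) *\<^sub>R tilted_mean \<theta>"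
    and has_derivative_gradient_llmgf: "(gradient llmgf has_derivative (\<lambda>h. hessian llmgf \<theta> *v h)) (at \<theta>)"
proof -
  note d = has_derivative_gradient_llmgf_covariance[OF assms]
  show 2: "(gradient llmgf has_derivative (\<lambda>h. hessian llmgf \<theta> *v h)) (at \<theta>)"
    unfolding hessian_def using d jacobian_works differentiableI by blast
  show "hessian llmgf \<theta> *v h = exp_moment (\<lambda>\<omega>. (h \<bullet> Y \<omega>) *\<^sub>R Y \<omega>) \<theta> /\<^sub>R mgf \<theta>
            - (h \<bullet> tilted_mean \<theta>) *\<^sub>R tilted_mean \<theta>"
    using has_derivative_unique[OF 2 d] by meson
qed

text \<open>The quadratic form of the Hessian is the variance of \<open>h \<bullet> Y\<close> under the tilted
measure: hence the sign, and the upper bound by the second moment, which is continuous in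
\<open>\<theta>\<close> and keeps \<open>xi2\<close> finite on compact sets.\<close>

lemma hessian_llmgf_bounds:
  assumes "\<theta> \<in> D"
  shows "0 \<le> h \<bullet> (hessian llmgf \<theta> *v h)"
    and "h \<bullet> (hessian llmgf \<theta> *v h) \<le> (norm h)\<^sup>2 * (exp_moment (\<lambda>\<omega>. norm (Y \<omega>) *\<^sub>R norm (Y \<omega>)) \<theta> / mgf \<theta>)"
proof -
  define q where "q = exp_moment (\<lambda>\<omega>. (h \<bullet> Y \<omega>) *\<^sub>R (h \<bullet> Y \<omega>)) \<theta>"
  define c where "c = h \<bullet> tilted_mean \<theta>"
  have Z: "mgf \<theta> > 0" by (rule mgf_pos[OF assms])
  have s2: "subexponential (\<lambda>\<omega>. (h \<bullet> Y \<omega>) *\<^sub>R Y \<omega>)" "subexponential (\<lambda>\<omega>. (h \<bullet> Y \<omega>) *\<^sub>R (h \<bullet> Y \<omega>))"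
    "subexponential (\<lambda>\<omega>. h \<bullet> Y \<omega>)" "subexponential (\<lambda>\<omega>. norm (Y \<omega>) *\<^sub>R norm (Y \<omega>))"
    by (intro subexponential_intros)+
  have quad: "h \<bullet> (hessian llmgf \<theta> *v h) = q / mgf \<theta> - c\<^sup>2"
    using exp_moment_inner[OF s2(1) assms, of h]
    by (simp add: hessian_llmgf[OF assms] q_def c_def inner_diff_right power2_eq_square divide_inverse mult_ac)
  have cV: "exp_moment (\<lambda>\<omega>. h \<bullet> Y \<omega>) \<theta> = c * mgf \<theta>"
    using exp_moment_inner[OF subexponential_Y assms, of h] Z by (simp add: c_def)
  note ii = integrable_exp_moment[OF s2(2) assms] integrable_exp_moment[OF s2(3) assms] 
    integrable_exp[OF assms] integrable_exp_moment[OF s2(4) assms]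
  have "0 \<le> expectation (\<lambda>\<omega>. exp (\<theta> \<bullet> Y \<omega>) * (h \<bullet> Y \<omega> - c)\<^sup>2)"
    by (intro Bochner_Integration.integral_nonneg) auto
  also have "\<dots> = expectation (\<lambda>\<omega>. exp (\<theta> \<bullet> Y \<omega>) *\<^sub>R ((h \<bullet> Y \<omega>) *\<^sub>R (h \<bullet> Y \<omega>))
      - 2 * c * (exp (\<theta> \<bullet> Y \<omega>) *\<^sub>R (h \<bullet> Y \<omega>)) + c\<^sup>2 * exp (\<theta> \<bullet> Y \<omega>))"
    by (intro Bochner_Integration.integral_cong) (auto simp: power2_eq_square algebra_simps)
  also have "\<dots> = q - 2 * c * exp_moment (\<lambda>\<omega>. h \<bullet> Y \<omega>) \<theta> + c\<^sup>2 * mgf \<theta>"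
    using ii unfolding q_def mgf_eq exp_moment_def by simp
  also have "\<dots> = q - c\<^sup>2 * mgf \<theta>" by (simp add: cV power2_eq_square)
  finally have "c\<^sup>2 * mgf \<theta> \<le> q" by simp
  hence "c\<^sup>2 \<le> q / mgf \<theta>" using Z by (simp add: pos_le_divide_eq)
  thus "0 \<le> h \<bullet> (hessian llmgf \<theta> *v h)" using quad by simp
  have "q \<le> expectation (\<lambda>\<omega>. (norm h)\<^sup>2 * (exp (\<theta> \<bullet> Y \<omega>) *\<^sub>R (norm (Y \<omega>) *\<^sub>R norm (Y \<omega>))))"
    unfolding q_def exp_moment_def
  proof (rule integral_mono)
    fix \<omega>
    have "\<bar>h \<bullet> Y \<omega>\<bar>\<^sup>2 \<le> (norm h * norm (Y \<omega>))\<^sup>2" by (intro power_mono Cauchy_Schwarz_ineq2) auto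
    hence "(h \<bullet> Y \<omega>) * (h \<bullet> Y \<omega>) \<le> (norm h)\<^sup>2 * (norm (Y \<omega>) * norm (Y \<omega>))"
      by (simp add: power2_eq_square mult_ac)
    hence "exp (\<theta> \<bullet> Y \<omega>) * ((h \<bullet> Y \<omega>) * (h \<bullet> Y \<omega>)) \<le> exp (\<theta> \<bullet> Y \<omega>) * ((norm h)\<^sup>2 * (norm (Y \<omega>) * norm (Y \<omega>)))"
      by (intro mult_left_mono) auto
    thus "exp (\<theta> \<bullet> Y \<omega>) *\<^sub>R ((h \<bullet> Y \<omega>) *\<^sub>R (h \<bullet> Y \<omega>))
      \<le> (norm h)\<^sup>2 * (exp (\<theta> \<bullet> Y \<omega>) *\<^sub>R (norm (Y \<omega>) *\<^sub>R norm (Y \<omega>)))" by (simp add: mult_ac)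
  qed (use ii in simp_all)
  also have "\<dots> = (norm h)\<^sup>2 * exp_moment (\<lambda>\<omega>. norm (Y \<omega>) *\<^sub>R norm (Y \<omega>)) \<theta>"
    using ii by (simp add: exp_moment_def)
  finally have "q / mgf \<theta> \<le> (norm h)\<^sup>2 * exp_moment (\<lambda>\<omega>. norm (Y \<omega>) *\<^sub>R norm (Y \<omega>)) \<theta> / mgf \<theta>"
    using Z by (simp add: divide_right_mono)
  moreover have "q / mgf \<theta> - c\<^sup>2 \<le> q / mgf \<theta>" by simp
  ultimately show "h \<bullet> (hessian llmgf \<theta> *v h)
      \<le> (norm h)\<^sup>2 * (exp_moment (\<lambda>\<omega>. norm (Y \<omega>) *\<^sub>R norm (Y \<omega>)) \<theta> / mgf \<theta>)"
    unfolding quad times_divide_eq_right by linarith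
qed

lemma continuous_on_llmgf: "continuous_on D llmgf"
  using has_derivative_llmgf by (meson has_derivative_at_withinI has_derivative_continuous_on)

lemma continuous_on_gradient_llmgf: "continuous_on D (gradient llmgf)"
  using has_derivative_gradient_llmgf by (meson has_derivative_at_withinI has_derivative_continuous_on)

text \<open>Jensen's inequality for the measure tilted by \<open>exp (\<theta> \<bullet> Y)\<close>, in the
form \<open>exp u \<ge> 1 + u\<close> with \<open>u\<close> the difference of
\<open>(\<zeta> - \<theta>) \<bullet> Y\<close> and its tilted mean. The point \<open>\<zeta>\<close> is any
point at which the exponential moment exists, inside \<open>D\<close> or not; this generality is needed for the
Legendre transform, a supremum over all of space.\<close>

lemma llmgf_above_tangent:
  assumes "\<theta> \<in> D" and int: "integrable M (\<lambda>\<omega>. exp (\<zeta> \<bullet> Y \<omega>))"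
  shows "llmgf \<theta> + (\<zeta> - \<theta>) \<bullet> gradient llmgf \<theta> \<le> llmgf \<zeta>"
proof -
  define c where "c = (\<zeta> - \<theta>) \<bullet> tilted_mean \<theta>"
  have Z: "mgf \<theta> > 0" by (rule mgf_pos[OF assms(1)])
  have s: "subexponential (\<lambda>\<omega>. (\<zeta> - \<theta>) \<bullet> Y \<omega>)" by (intro subexponential_intros)
  note ii = integrable_exp_moment[OF s assms(1)] integrable_exp[OF assms(1)]
  have cV: "exp_moment (\<lambda>\<omega>. (\<zeta> - \<theta>) \<bullet> Y \<omega>) \<theta> = c * mgf \<theta>"
    unfolding exp_moment_inner[OF subexponential_Y assms(1)] c_def using Z by simp
  have "exp c * mgf \<theta> = exp c * ((1 - c) * mgf \<theta> + exp_moment (\<lambda>\<omega>. (\<zeta> - \<theta>) \<bullet> Y \<omega>) \<theta>)"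
    by (simp only: cV) (simp add: algebra_simps)
  also have "\<dots> = expectation (\<lambda>\<omega>. exp c * ((1 - c) * exp (\<theta> \<bullet> Y \<omega>) + exp (\<theta> \<bullet> Y \<omega>) *\<^sub>R ((\<zeta> - \<theta>) \<bullet> Y \<omega>)))"
    using ii unfolding mgf_eq exp_moment_def by simp
  also have "\<dots> \<le> expectation (\<lambda>\<omega>. exp (\<zeta> \<bullet> Y \<omega>))"
  proof (rule integral_mono)
    fix \<omega>
    have "1 + ((\<zeta> - \<theta>) \<bullet> Y \<omega> - c) \<le> exp ((\<zeta> - \<theta>) \<bullet> Y \<omega> - c)" by (rule exp_ge_add_one_self)
    hence "exp c * exp (\<theta> \<bullet> Y \<omega>) * (1 + ((\<zeta> - \<theta>) \<bullet> Y \<omega> - c))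
      \<le> exp c * exp (\<theta> \<bullet> Y \<omega>) * exp ((\<zeta> - \<theta>) \<bullet> Y \<omega> - c)" by (intro mult_left_mono) auto
    also have "\<dots> = exp (\<zeta> \<bullet> Y \<omega>)" by (simp add: inner_diff_left flip: exp_add)
    finally show "exp c * ((1 - c) * exp (\<theta> \<bullet> Y \<omega>) + exp (\<theta> \<bullet> Y \<omega>) *\<^sub>R ((\<zeta> - \<theta>) \<bullet> Y \<omega>)) \<le> exp (\<zeta> \<bullet> Y \<omega>)"
      by (simp add: algebra_simps)
  qed (use ii int in auto)
  finally have le: "exp c * mgf \<theta> \<le> expectation (\<lambda>\<omega>. exp (\<zeta> \<bullet> Y \<omega>))" .
  have "c + ln (mgf \<theta>) = ln (exp c * mgf \<theta>)" using Z by (simp add: ln_mult)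
  also have "\<dots> \<le> ln (expectation (\<lambda>\<omega>. exp (\<zeta> \<bullet> Y \<omega>)))" 
    using le order.strict_trans2[OF mult_pos_pos[OF exp_gt_zero Z] le] Z by simp
  also have "\<dots> = llmgf \<zeta>" using int by (simp add: log_mgf_def)
  finally show ?thesis using assms by (simp add: gradient_llmgf c_def log_mgf_eq)
qed

lemma legendre_gradient_llmgf:
  assumes "\<theta> \<in> D"
  shows "legendre (log_mgf M Y) (gradient llmgf \<theta>) = ereal (\<theta> \<bullet> gradient llmgf \<theta> - llmgf \<theta>)"
  unfolding legendre_def
proof (rule antisym)
  show "(SUP \<zeta>. ereal (\<zeta> \<bullet> gradient llmgf \<theta>) - log_mgf M Y \<zeta>) \<le> ereal (\<theta> \<bullet> gradient llmgf \<theta> - llmgf \<theta>)"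
  proof (rule SUP_least)
    fix \<zeta>
    show "ereal (\<zeta> \<bullet> gradient llmgf \<theta>) - log_mgf M Y \<zeta> \<le> ereal (\<theta> \<bullet> gradient llmgf \<theta> - llmgf \<theta>)"
    proof (cases "integrable M (\<lambda>\<omega>. exp (\<zeta> \<bullet> Y \<omega>))")
      case True
      thus ?thesis using llmgf_above_tangent[OF assms True] by (simp add: log_mgf_def inner_diff_left)
    qed (simp add: log_mgf_def)
  qed
  show "ereal (\<theta> \<bullet> gradient llmgf \<theta> - llmgf \<theta>) \<le> (SUP \<zeta>. ereal (\<zeta> \<bullet> gradient llmgf \<theta>) - log_mgf M Y \<zeta>)"
    using assms by (intro SUP_upper2[of \<theta>]) (auto simp: log_mgf_eq)
qed

lemma le_Lambda_star_sup:
  assumes "compact B" "B \<subseteq> D" "x \<in> B"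
  shows "x \<bullet> gradient llmgf x - llmgf x \<le> real_of_ereal (Lambda_star_sup (log_mgf M Y) B)"
proof -
  have "compact ((\<lambda>x. x \<bullet> gradient llmgf x - llmgf x) ` B)"
    by (intro compact_continuous_image continuous_intros assms(1)
        continuous_on_subset[OF continuous_on_gradient_llmgf assms(2)]
        continuous_on_subset[OF continuous_on_llmgf assms(2)])
  then obtain K where K: "\<And>x. x \<in> B \<Longrightarrow> norm (x \<bullet> gradient llmgf x - llmgf x) \<le> K"
    by (meson bounded_iff compact_imp_bounded imageI)
  have "Lambda_star_sup (log_mgf M Y) B = (SUP x\<in>B. ereal (x \<bullet> gradient llmgf x - llmgf x))"
    unfolding Lambda_star_sup_def using assms legendre_gradient_llmgf by (intro SUP_cong) auto
  thus ?thesis using le_real_of_ereal_SUP[of B "\<lambda>x. x \<bullet> gradient llmgf x - llmgf x" K x] assms K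
    by (metis abs_le_D1 real_norm_def)
qed

lemma le_xi2:
  assumes "compact B" "B \<subseteq> D" "x \<in> B"
  shows "1 / 2 * (x \<bullet> (hessian llmgf x *v x)) \<le> real_of_ereal (xi2 (log_mgf M Y) B)"
proof -
  define g where "g x = (norm x)\<^sup>2 * (exp_moment (\<lambda>\<omega>. norm (Y \<omega>) *\<^sub>R norm (Y \<omega>)) x / mgf x)" for x
  have "continuous_on D (exp_moment (\<lambda>\<omega>. norm (Y \<omega>) *\<^sub>R norm (Y \<omega>)))" "continuous_on D mgf"
    by (intro continuous_on_exp_moment subexponential_intros)+
  hence "continuous_on D g" unfolding g_def[abs_def] using mgf_pos
    by (intro continuous_intros) (auto simp: less_imp_neq[symmetric])
  hence "compact (g ` B)" using assms by (intro compact_continuous_image continuous_on_subset[of D g B])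
  then obtain K where K: "\<And>x. x \<in> B \<Longrightarrow> norm (g x) \<le> K"
    by (meson bounded_iff compact_imp_bounded imageI)
  have "1 / 2 * (x \<bullet> (hessian llmgf x *v x)) \<le> K" if "x \<in> B" for x
  proof -
    have xD: "x \<in> D" using that assms(2) by blast
    have "x \<bullet> (hessian llmgf x *v x) \<le> g x" using hessian_llmgf_bounds(2)[OF xD] by (simp add: g_def)
    also have "\<dots> \<le> K" using K[OF that] by simp
    finally show ?thesis using hessian_llmgf_bounds(1)[OF xD, of x] by linarith
  qed
  thus ?thesis unfolding xi2_def
    using le_real_of_ereal_SUP[of B "\<lambda>x. 1 / 2 * (x \<bullet> (hessian llmgf x *v x))" K x] assms by blast
qed

text \<open>Taylor's formula for \<open>u \<mapsto> llmgf ((1 + u) *\<^sub>R x)\<close>. Its second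
derivative is the quadratic form of the Hessian in the direction \<open>x\<close>, whereas \<open>xi2\<close>
evaluates the Hessian in the direction of the point itself, \<open>(1 + u) *\<^sub>R x\<close>; as the form
is nonnegative, the latter is larger.\<close>

lemma llmgf_ray_le:
  assumes s: "s > 0" and ray: "\<And>u. 0 \<le> u \<Longrightarrow> u \<le> s \<Longrightarrow> (1 + u) *\<^sub>R x \<in> D"
    and bd: "\<And>u. 0 \<le> u \<Longrightarrow> u \<le> s \<Longrightarrow>
       1 / 2 * (((1 + u) *\<^sub>R x) \<bullet> (hessian llmgf ((1 + u) *\<^sub>R x) *v ((1 + u) *\<^sub>R x))) \<le> \<xi>"
  shows "llmgf ((1 + s) *\<^sub>R x) \<le> llmgf x + s * (x \<bullet> gradient llmgf x) + s\<^sup>2 * \<xi>"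
proof -
  define p where "p u = (1 + u) *\<^sub>R x" for u :: real
  \<comment> \<open>The function on the ray and its first two derivatives, indexed as Taylor's
  formula wants them.\<close>
  define df :: "nat \<Rightarrow> real \<Rightarrow> real" where
    "df m u = (if m = 0 then llmgf (p u) else if m = 1 then x \<bullet> gradient llmgf (p u)
       else x \<bullet> (hessian llmgf (p u) *v x))" for m u
  have dp: "(p has_derivative (\<lambda>h. h *\<^sub>R x)) (at u)" for u
    unfolding p_def[abs_def] by (auto intro!: derivative_eq_intros)
  have d0: "(df 0 has_real_derivative df 1 u) (at u)" if "0 \<le> u" "u \<le> s" for u
  proof -
    have "((\<lambda>u. llmgf (p u)) has_derivative (\<lambda>h. (h *\<^sub>R x) \<bullet> gradient llmgf (p u))) (at u)"
      using has_derivative_compose[OF dp has_derivative_llmgf] ray[OF that] by (simp add: p_def)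
    hence "((\<lambda>u. llmgf (p u)) has_derivative (*) (df 1 u)) (at u)"
      by (rule has_derivative_eq_rhs) (auto simp: df_def mult.commute)
    moreover have "df 0 = (\<lambda>u. llmgf (p u))" by (auto simp: df_def)
    ultimately show ?thesis by (simp only: has_field_derivative_def)
  qed
  have d1: "(df 1 has_real_derivative df 2 u) (at u)" if "0 \<le> u" "u \<le> s" for u
  proof -
    have "((\<lambda>u. gradient llmgf (p u)) has_derivative (\<lambda>h. hessian llmgf (p u) *v (h *\<^sub>R x))) (at u)"
      using has_derivative_compose[OF dp has_derivative_gradient_llmgf] ray[OF that] by (simp add: p_def)
    hence "((\<lambda>u. x \<bullet> gradient llmgf (p u)) has_derivative (\<lambda>h. x \<bullet> (hessian llmgf (p u) *v (h *\<^sub>R x)))) (at u)"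
      by (rule has_derivative_inner_right)
    hence "((\<lambda>u. x \<bullet> gradient llmgf (p u)) has_derivative (*) (df 2 u)) (at u)"
      by (rule has_derivative_eq_rhs) (auto simp: df_def mult.commute matrix_vector_mult_scaleR)
    moreover have "df 1 = (\<lambda>u. x \<bullet> gradient llmgf (p u))" by (auto simp: df_def)
    ultimately show ?thesis by (simp only: has_field_derivative_def)
  qed
  have "\<exists>t. 0 < t \<and> t < s \<and> df 0 s = (\<Sum>m<2. df m 0 / fact m * (s - 0) ^ m) + df 2 t / fact 2 * (s - 0)\<^sup>2"
  proof (rule Taylor_up)
    show "\<forall>m t. m < 2 \<and> 0 \<le> t \<and> t \<le> s \<longrightarrow> (df m has_real_derivative df (Suc m) t) (at t)"
      using d0 d1 by (auto simp: less_Suc_eq numeral_2_eq_2)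
  qed (use s in auto)
  then obtain t where t: "0 < t" "t < s"
    "df 0 s = (\<Sum>m<2. df m 0 / fact m * (s - 0) ^ m) + df 2 t / fact 2 * (s - 0)\<^sup>2" by blast
  have "df 2 t / 2 \<le> \<xi>"
  proof -
    have "p t \<in> D" using ray t by (simp add: p_def)
    hence nn: "0 \<le> df 2 t" using hessian_llmgf_bounds(1)[of "p t" x] by (simp add: df_def)
    have "1 * df 2 t \<le> (1 + t)\<^sup>2 * df 2 t" using t nn by (intro mult_right_mono) auto
    also have "\<dots> = ((1 + t) *\<^sub>R x) \<bullet> (hessian llmgf (p t) *v ((1 + t) *\<^sub>R x))"
      by (simp add: df_def matrix_vector_mult_scaleR power2_eq_square)
    finally show ?thesis using bd[of t] t by (simp add: p_def)
  qed
  hence "df 2 t / 2 * s\<^sup>2 \<le> \<xi> * s\<^sup>2" by (intro mult_right_mono) auto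
  thus ?thesis using t(3) by (simp add: df_def p_def numeral_2_eq_2 mult_ac)
qed

end

section \<open>Sums over disjoint blocks\<close>

lemma (in prob_space) indep_vars_block_sums:
  fixes X :: "nat \<Rightarrow> 'a \<Rightarrow> 'b::euclidean_space"
  assumes ind: "indep_vars (\<lambda>_. borel) X {1..}"
  shows "indep_vars (\<lambda>_. borel) (\<lambda>j \<omega>. \<Sum>i = (j - 1) * n + 1..j * n. X i \<omega>) {1..m}"
proof -
  \<comment> \<open>Disjoint index sets give independent families, and each sum is a function of its
  family.\<close>
  define K where "K j = {(j - 1) * n + 1..j * n}" for j
  have disj: "disjoint_family_on K {1..m}"
  proof -
    have "K i \<inter> K j = {}" if "i < j" for i j
    proof -
      have *: "i * n \<le> (j - 1) * n" using that by (intro mult_right_mono) auto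
      have False if "x \<in> K i" "x \<in> K j" for x
        using that * unfolding K_def atLeastAtMost_iff by linarith
      thus ?thesis by blast
    qed
    thus ?thesis unfolding disjoint_family_on_def by (metis Int_commute linorder_neqE_nat)
  qed
  have "indep_vars (\<lambda>j. PiM (K j) (\<lambda>_. borel)) (\<lambda>j \<omega>. restrict (\<lambda>i. X i \<omega>) (K j)) {1..m}"
    by (rule indep_vars_restrict[OF ind _ disj]) (auto simp: K_def)
  hence "indep_vars (\<lambda>_. borel) (\<lambda>j \<omega>. \<Sum>i\<in>K j. restrict (\<lambda>i. X i \<omega>) (K j) i) {1..m}"
    by (rule indep_vars_compose2[where Y = "\<lambda>j f. \<Sum>i\<in>K j. f i"]) measurable
  moreover have "(\<lambda>j \<omega>. \<Sum>i\<in>K j. restrict (\<lambda>i. X i \<omega>) (K j) i) = (\<lambda>j \<omega>. \<Sum>i\<in>K j. X i \<omega>)"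
    by (intro ext sum.cong) auto
  ultimately show ?thesis by (simp add: K_def)
qed

locale iid_exponential_moments = exponential_moments M "X 1" D
  for M :: "'w measure" and X :: "nat \<Rightarrow> 'w \<Rightarrow> real ^ 'n" and D +
  assumes indep: "indep_vars (\<lambda>_. borel) X {1..}"
    and ident: "i \<ge> 1 \<Longrightarrow> distr M borel (X i) = distr M borel (X 1)"
begin

definition block_sum :: "nat \<Rightarrow> nat \<Rightarrow> 'w \<Rightarrow> real ^ 'n" where
  "block_sum n j \<omega> = (\<Sum>i = (j - 1) * n + 1..j * n. X i \<omega>)"

lemma X_measurable: "i \<ge> 1 \<Longrightarrow> X i \<in> borel_measurable M"
  using indep_vars_random_variable[OF indep, of i] by simp

lemma block_sum_measurable[measurable]: "block_sum n j \<in> borel_measurable M"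
  unfolding block_sum_def[abs_def] using X_measurable by (intro borel_measurable_sum) auto

lemma exp_block_sum:
  assumes "\<theta> \<in> D" "j \<ge> 1"
  shows "integrable M (\<lambda>\<omega>. exp (\<theta> \<bullet> block_sum n j \<omega>))"
    and "expectation (\<lambda>\<omega>. exp (\<theta> \<bullet> block_sum n j \<omega>)) = exp (n * llmgf \<theta>)"
proof -
  define K where "K = {(j - 1) * n + 1..j * n}"
  have K: "finite K" "card K = n" "K \<subseteq> {1..}"
    using assms(2) by (auto simp: K_def diff_mult_distrib)
  have prod: "exp (\<theta> \<bullet> block_sum n j \<omega>) = (\<Prod>i\<in>K. exp (\<theta> \<bullet> X i \<omega>))" for \<omega>
    unfolding block_sum_def K_def[symmetric] inner_sum_right using K(1) by (rule exp_sum)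
  have i: "integrable M (\<lambda>\<omega>. exp (\<theta> \<bullet> X i \<omega>))" "expectation (\<lambda>\<omega>. exp (\<theta> \<bullet> X i \<omega>)) = mgf \<theta>"
    if "i \<in> K" for i
  proof -
    have mi: "X i \<in> borel_measurable M" "i \<ge> 1" using that K(3) X_measurable by auto
    have "integrable (distr M borel (X 1)) (\<lambda>x. exp (\<theta> \<bullet> x))"
      using integrable_exp[OF assms(1)] Y_measurable by (subst integrable_distr_eq) auto
    thus "integrable M (\<lambda>\<omega>. exp (\<theta> \<bullet> X i \<omega>))"
      unfolding ident[OF mi(2), symmetric] using mi(1) by (subst (asm) integrable_distr_eq) auto
    have "expectation (\<lambda>\<omega>. exp (\<theta> \<bullet> X i \<omega>)) = integral\<^sup>L (distr M borel (X i)) (\<lambda>x. exp (\<theta> \<bullet> x))"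
      using mi(1) by (subst integral_distr) auto
    also have "\<dots> = mgf \<theta>" unfolding ident[OF mi(2)] mgf_eq using Y_measurable by (subst integral_distr) auto
    finally show "expectation (\<lambda>\<omega>. exp (\<theta> \<bullet> X i \<omega>)) = mgf \<theta>" .
  qed
  have ind: "indep_vars (\<lambda>_. borel) (\<lambda>i \<omega>. exp (\<theta> \<bullet> X i \<omega>)) K"
    by (rule indep_vars_compose2[OF indep_vars_subset[OF indep K(3)]]) simp
  show "integrable M (\<lambda>\<omega>. exp (\<theta> \<bullet> block_sum n j \<omega>))"
    unfolding prod by (rule indep_vars_integrable[OF K(1) ind i(1)])
  have "expectation (\<lambda>\<omega>. exp (\<theta> \<bullet> block_sum n j \<omega>)) = (\<Prod>i\<in>K. mgf \<theta>)"
    unfolding prod using indep_vars_lebesgue_integral[OF K(1) ind i(1)] i(2) by simp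
  also have "\<dots> = mgf \<theta> ^ n" using K(2) by simp
  also have "mgf \<theta> = exp (llmgf \<theta>)" 
    unfolding llmgf_eq[OF assms(1)] by (rule mgf_pos[OF assms(1), THEN exp_ln, symmetric])
  also have "exp (llmgf \<theta>) ^ n = exp (n * llmgf \<theta>)" by (rule exp_of_nat_mult[symmetric])
  finally show "expectation (\<lambda>\<omega>. exp (\<theta> \<bullet> block_sum n j \<omega>)) = exp (n * llmgf \<theta>)" .
qed

text \<open>The mean of \<open>m\<close> independent nonnegative variables of mean 1; see
\<open>emp_log_mgf_eq\<close> for its relation to the empirical function.\<close>

definition normalized_mean :: "nat \<Rightarrow> nat \<Rightarrow> real ^ 'n \<Rightarrow> 'w \<Rightarrow> real" where
  "normalized_mean m n \<theta> \<omega> = (\<Sum>j = 1..m. exp (\<theta> \<bullet> block_sum n j \<omega> - n * llmgf \<theta>)) / m"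

lemma normalized_mean_measurable[measurable]: "normalized_mean m n \<theta> \<in> borel_measurable M"
  unfolding normalized_mean_def[abs_def] by measurable

lemma emp_log_mgf_eq:
  assumes "n \<ge> 1" "k n > 0"
  shows "emp_log_mgf k X n \<omega> \<theta> = llmgf \<theta> + ln (normalized_mean (k n) n \<theta> \<omega>) / n"
    and "0 < normalized_mean (k n) n \<theta> \<omega>"
proof -
  let ?G = "\<Sum>j = 1..k n. exp (\<theta> \<bullet> block_sum n j \<omega>)"
  have G: "?G > 0" using assms(2) by (intro sum_pos) auto
  have Z: "normalized_mean (k n) n \<theta> \<omega> = 1 / k n * ?G / exp (n * llmgf \<theta>)"
    by (simp add: normalized_mean_def exp_diff sum_divide_distrib mult.commute)
  show "0 < normalized_mean (k n) n \<theta> \<omega>" using G assms by (simp add: Z)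
  have "ln (normalized_mean (k n) n \<theta> \<omega>) = ln (1 / k n * ?G) - n * llmgf \<theta>"
    unfolding Z using G assms(2) by (subst ln_div) auto
  thus "emp_log_mgf k X n \<omega> \<theta> = llmgf \<theta> + ln (normalized_mean (k n) n \<theta> \<omega>) / n"
    unfolding emp_log_mgf_def block_sum_def[symmetric]
    using assms(1) by (simp add: diff_divide_distrib)
qed

lemma expectation_normalized_mean:
  assumes "\<theta> \<in> D" "m > 0"
  shows "integrable M (normalized_mean m n \<theta>)" "expectation (normalized_mean m n \<theta>) = 1"
proof -
  have *: "integrable M (\<lambda>\<omega>. exp (\<theta> \<bullet> block_sum n j \<omega> - n * llmgf \<theta>))"
    "expectation (\<lambda>\<omega>. exp (\<theta> \<bullet> block_sum n j \<omega> - n * llmgf \<theta>)) = 1" if "j \<in> {1..m}" for j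
    using exp_block_sum[OF assms(1), of j n] that by (auto simp: exp_diff)
  show "integrable M (normalized_mean m n \<theta>)" 
    unfolding normalized_mean_def[abs_def]
    by (intro Bochner_Integration.integrable_divide Bochner_Integration.integrable_sum *(1))
  have "expectation (normalized_mean m n \<theta>)
      = (\<Sum>j = 1..m. expectation (\<lambda>\<omega>. exp (\<theta> \<bullet> block_sum n j \<omega> - n * llmgf \<theta>))) / m"
    unfolding normalized_mean_def[abs_def] integral_divide_zero
    by (intro arg_cong[where f = "\<lambda>x. x / m"] Bochner_Integration.integral_sum *(1))
  also have "\<dots> = 1" using *(2) assms(2) by simp
  finally show "expectation (normalized_mean m n \<theta>) = 1" .
qed

text \<open>A crude upper bound that holds throughout \<open>D\<close> and for every number of blocks, as it
uses only the first moment.\<close>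

lemma prob_normalized_mean_large:
  assumes "\<theta> \<in> D" "m > 0"
  shows "prob {\<omega>\<in>space M. normalized_mean m n \<theta> \<omega> \<ge> exp n} \<le> exp (- n)"
proof -
  have nonneg: "0 \<le> normalized_mean m n \<theta> \<omega>" for \<omega>
    unfolding normalized_mean_def by (intro divide_nonneg_nonneg sum_nonneg) auto
  have "prob {\<omega>\<in>space M. normalized_mean m n \<theta> \<omega> \<ge> exp n} \<le> expectation (normalized_mean m n \<theta>) / exp n"
    using expectation_normalized_mean[OF assms]
    by (intro integral_Markov_inequality_measure[of _ _ "space M"])
       (auto simp: nonneg)
  thus ?thesis using expectation_normalized_mean[OF assms] by (simp add: exp_minus divide_inverse)
qed

lemma prob_normalized_mean_deviation:
  assumes \<theta>: "\<theta> \<in> D" "(1 + s) *\<^sub>R \<theta> \<in> D" and s: "0 \<le> s" "s \<le> 1" and m: "m > 0" and e: "e > 0"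
  shows "prob {\<omega>\<in>space M. \<bar>normalized_mean m n \<theta> \<omega> - 1\<bar> > e}
     \<le> 5 * (real m powr (- s) * e powr (- (1 + s)) * exp (n * (llmgf ((1 + s) *\<^sub>R \<theta>) - (1 + s) * llmgf \<theta>)))"
proof -
  define Y where "Y j \<omega> = exp (\<theta> \<bullet> block_sum n j \<omega> - n * llmgf \<theta>)" for j \<omega>
  have Y0: "0 \<le> Y j \<omega>" for j \<omega> by (simp add: Y_def)
  define J where "J = {1..m}"
  have J: "finite J" "J \<noteq> {}" "card J = m" using m by (auto simp: J_def)
  have ind: "indep_vars (\<lambda>_. borel) Y J"
    unfolding Y_def[abs_def] J_def
    using indep_vars_block_sums[OF indep, of n m] unfolding block_sum_def[symmetric]
    by (rule indep_vars_compose2[where Y = "\<lambda>_ x. exp (\<theta> \<bullet> x - n * llmgf \<theta>)"]) measurable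
  have pow: "Y j \<omega> powr (1 + s)
      = exp (((1 + s) *\<^sub>R \<theta>) \<bullet> block_sum n j \<omega>) / exp (n * ((1 + s) * llmgf \<theta>))" for j \<omega>
    by (simp add: Y_def powr_def algebra_simps flip: exp_diff)
  have mean: "integrable M (Y j)" "expectation (Y j) = 1" if "j \<in> J" for j
    using exp_block_sum[OF \<theta>(1), of j n] that unfolding Y_def[abs_def] J_def by (auto simp: exp_diff)
  have mom: "integrable M (\<lambda>\<omega>. Y j \<omega> powr (1 + s))"
    "expectation (\<lambda>\<omega>. Y j \<omega> powr (1 + s)) = exp (n * (llmgf ((1 + s) *\<^sub>R \<theta>) - (1 + s) * llmgf \<theta>))"
    if "j \<in> J" for j
    using exp_block_sum[OF \<theta>(2), of j n] that unfolding pow J_def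
    by (auto simp: right_diff_distrib exp_diff)
  have "prob {\<omega>\<in>space M. \<bar>(\<Sum>j\<in>J. Y j \<omega>) / card J - 1\<bar> > e}
     \<le> 5 * (real (card J) powr (1 - (1 + s)) * e powr (- (1 + s))
          * exp (n * (llmgf ((1 + s) *\<^sub>R \<theta>) - (1 + s) * llmgf \<theta>)))"
    using J mean mom s e by (intro prob_mean_deviation_le ind) (auto simp: Y0)
  moreover have "normalized_mean m n \<theta> \<omega> = (\<Sum>j\<in>J. Y j \<omega>) / m" for \<omega>
    unfolding normalized_mean_def Y_def J_def ..
  ultimately show ?thesis by (simp add: J(3))
qed

text \<open>The choice \<open>s = sqrt e\<close> makes the second order term \<open>s\<^sup>2 * xi2\<close>
of the Taylor expansion equal to \<open>e * xi2\<close>. The right-hand side no longer depends on the point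
\<open>x\<close> of \<open>B\<close>.\<close>

lemma prob_normalized_mean_deviation_uniform:
  assumes B: "compact B" "B \<subseteq> D" "x \<in> B" 
    and B': "compact B'" "B' \<subseteq> D" "\<And>u. 0 \<le> u \<Longrightarrow> u \<le> sqrt e \<Longrightarrow> (1 + u) *\<^sub>R x \<in> B'"
    and m: "m > 0" and e: "0 < e" "e \<le> 1"
  shows "prob {\<omega>\<in>space M. \<bar>normalized_mean m n x \<omega> - 1\<bar> > e}
     \<le> 5 * exp 2 * (exp (- sqrt e * (ln m - n * real_of_ereal (Lambda_star_sup (log_mgf M (X 1)) B)))
          * exp (real_of_ereal (xi2 (log_mgf M (X 1)) B') * e * n)) * inverse e"
proof -
  define s where "s = sqrt e"
  have s: "0 < s" "s \<le> 1" "s\<^sup>2 = e" using e by (auto simp: s_def)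
  define a where "a = real_of_ereal (Lambda_star_sup (log_mgf M (X 1)) B)"
  define b where "b = real_of_ereal (xi2 (log_mgf M (X 1)) B')"
  have ray: "(1 + u) *\<^sub>R x \<in> B'" if "0 \<le> u" "u \<le> s" for u using B' that by (simp add: s_def)
  have "llmgf ((1 + s) *\<^sub>R x) \<le> llmgf x + s * (x \<bullet> gradient llmgf x) + s\<^sup>2 * b"
  proof (rule llmgf_ray_le[OF s(1)])
    fix u assume u: "0 \<le> u" "u \<le> s"
    show "(1 + u) *\<^sub>R x \<in> D" using ray[OF u] B' by blast
    show "1 / 2 * (((1 + u) *\<^sub>R x) \<bullet> (hessian llmgf ((1 + u) *\<^sub>R x) *v ((1 + u) *\<^sub>R x))) \<le> b"
      unfolding b_def by (rule le_xi2[OF B'(1,2) ray[OF u]])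
  qed
  moreover have "s * (x \<bullet> gradient llmgf x - llmgf x) \<le> s * a"
    unfolding a_def using s by (intro mult_left_mono le_Lambda_star_sup[OF B]) auto
  ultimately have "llmgf ((1 + s) *\<^sub>R x) - (1 + s) * llmgf x \<le> s * a + s\<^sup>2 * b"
    by (simp add: algebra_simps)
  hence "exp (n * (llmgf ((1 + s) *\<^sub>R x) - (1 + s) * llmgf x)) \<le> exp (n * (s * a + s\<^sup>2 * b))"
    by (simp add: mult_left_mono)
  hence exp_le: "exp (n * (llmgf ((1 + s) *\<^sub>R x) - (1 + s) * llmgf x)) \<le> exp (n * (s * a + e * b))"
    by (simp add: s)
  have "e powr (- (1 + s)) = e powr (- s) * inverse e"
    using e by (simp add: powr_diff powr_minus divide_inverse)
  also have "\<dots> \<le> exp 2 * inverse e"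
    unfolding s_def using powr_neg_sqrt_le[OF e(1)] e by (intro mult_right_mono) auto
  finally have e_le: "e powr (- (1 + s)) \<le> exp 2 * inverse e" .
  have "prob {\<omega>\<in>space M. \<bar>normalized_mean m n x \<omega> - 1\<bar> > e}
     \<le> 5 * (real m powr (- s) * e powr (- (1 + s)) * exp (n * (llmgf ((1 + s) *\<^sub>R x) - (1 + s) * llmgf x)))"
    using B B' ray[of s] s e m by (intro prob_normalized_mean_deviation) auto
  also have "\<dots> \<le> 5 * (real m powr (- s) * (exp 2 * inverse e) * exp (n * (s * a + e * b)))"
    using exp_le e_le e by (intro mult_left_mono mult_mono) auto
  also have "\<dots> = 5 * exp 2 * (exp (- s * ln m) * exp (n * (s * a + e * b))) * inverse e"
    using m by (simp add: powr_def)
  also have "exp (- s * ln m) * exp (n * (s * a + e * b)) = exp (- s * (ln m - n * a)) * exp (b * e * n)"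
    by (simp add: algebra_simps flip: exp_add)
  finally show ?thesis by (simp add: a_def b_def s_def)
qed

end

section \<open>From finite sets of parameters to compact sets\<close>

lemma (in iid_exponential_moments) emp_log_mgf_convex:
  assumes "k n > 0"
  shows "convex_on UNIV (emp_log_mgf k X n \<omega>)"
  unfolding emp_log_mgf_def[abs_def] using assms
  by (intro convex_on_cmul convex_on_ln_sum_exp) auto

text \<open>The deterministic part of the argument, for one outcome and one \<open>n\<close>. On
\<open>F\<close>, the bound \<open>exp n\<close> for the normalized mean says that the empirical function
exceeds \<open>llmgf\<close> by at most 1. Convexity turns this into an upper bound \<open>K\<close> near
\<open>B\<close>, and on the net \<open>- K\<close> is a lower bound, so the Lipschitz estimate applies with
constant \<open>2 * K / r\<close>. The function \<open>llmgf\<close> itself has Lipschitz constant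
\<open>G\<close> on \<open>B\<close>: tangents at both points are used, because the segment between them may
leave \<open>B\<close>.\<close>

lemma (in iid_exponential_moments) emp_log_mgf_uniformly_close:
  assumes n: "n \<ge> 1" "k n > 0" and e: "0 < e" "e \<le> 2 / 5" and t: "t \<le> r" and r: "0 < r"
    and N: "N \<subseteq> B" "\<And>y. y \<in> B \<Longrightarrow> \<exists>x\<in>N. dist y x \<le> t" "B \<subseteq> D"
    and F: "F \<subseteq> D" "\<And>x. x \<in> B \<Longrightarrow> cball x r \<subseteq> convex hull F"
    and K: "\<And>v. v \<in> F \<Longrightarrow> llmgf v + 1 \<le> K" "\<And>x. x \<in> B \<Longrightarrow> \<bar>llmgf x\<bar> + 1 \<le> K"
    and G: "\<And>x. x \<in> B \<Longrightarrow> norm (gradient llmgf x) \<le> G"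
    and goodN: "\<And>x. x \<in> N \<Longrightarrow> \<bar>normalized_mean (k n) n x \<omega> - 1\<bar> \<le> e"
    and goodF: "\<And>v. v \<in> F \<Longrightarrow> normalized_mean (k n) n v \<omega> \<le> exp n"
  shows "\<And>x. x \<in> N \<Longrightarrow> \<bar>emp_log_mgf k X n \<omega> x - llmgf x\<bar> \<le> e * (1 + e) / n"
    and "\<And>y. y \<in> B \<Longrightarrow> \<bar>emp_log_mgf k X n \<omega> y - llmgf y\<bar> \<le> e * (1 + e) / n + (2 * K / r + G) * t"
proof -
  define f where "f = emp_log_mgf k X n \<omega>"
  have fx: "f x = llmgf x + ln (normalized_mean (k n) n x \<omega>) / n" "0 < normalized_mean (k n) n x \<omega>" for x
    unfolding f_def by (rule emp_log_mgf_eq[where k = k, OF n])+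
  show near: "\<bar>emp_log_mgf k X n \<omega> x - llmgf x\<bar> \<le> e * (1 + e) / n" if "x \<in> N" for x
    using abs_ln_le_of_near_one[OF e goodN[OF that]] n(1)
    by (simp add: fx(1)[unfolded f_def] divide_right_mono)
  fix y assume y: "y \<in> B"
  then obtain x where x: "x \<in> N" "dist y x \<le> t" using N by blast
  have xB: "x \<in> B" using x N by blast
  have up: "f z \<le> K" if z: "dist x z \<le> r \<or> dist y z \<le> r" for z
  proof -
    have "convex_on (convex hull F) f"
      unfolding f_def by (rule convex_on_subset[OF emp_log_mgf_convex[where k = k, OF n(2)]]) (auto simp: convex_convex_hull)
    moreover have "\<forall>v\<in>F. f v \<le> K"
    proof
      fix v assume v: "v \<in> F"
      have "ln (normalized_mean (k n) n v \<omega>) \<le> ln (exp n)"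
        using goodF[OF v] fx(2)[of v] by (subst ln_le_cancel_iff) auto
      hence "ln (normalized_mean (k n) n v \<omega>) / n \<le> 1" using n(1) by simp
      thus "f v \<le> K" using K(1)[OF v] fx(1)[of v] by linarith
    qed
    ultimately have "\<forall>z\<in>convex hull F. f z \<le> K" by (rule convex_on_convex_hull_bound)
    moreover have "z \<in> convex hull F" using z F(2)[OF xB] F(2)[OF y] by (auto simp: subset_iff)
    ultimately show ?thesis by blast
  qed
  have "e * (1 + e) / n \<le> 1"
  proof -
    have "e * (1 + e) \<le> 1 * 1" using e by (intro order_trans[OF mult_mono[of e "2/5" "1 + e" "7/5"]]) auto
    thus ?thesis using n(1) by (simp add: divide_le_eq_1)
  qed
  hence lo: "- K \<le> f x" using near[OF x(1)] K(2)[OF xB] unfolding f_def by linarith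
  have K0: "0 \<le> K" using K(2)[OF xB] by linarith
  have G0: "0 \<le> G" using order_trans[OF norm_ge_zero G[OF xB]] .
  have d: "dist x y \<le> t" using x by (simp add: dist_commute)
  have "\<bar>f y - f x\<bar> \<le> 2 * K / r * dist x y"
    using convex_on_lipschitz_at[of f r x y K] emp_log_mgf_convex[where k = k, OF n(2)] r up lo d t
    by (auto simp: f_def)
  also have "\<dots> \<le> 2 * K / r * t" using d K0 r by (intro mult_left_mono) auto
  finally have 1: "\<bar>f y - f x\<bar> \<le> 2 * K / r * t" .
  have tangent: "llmgf a - llmgf b \<le> G * t" if "a \<in> B" "b \<in> B" "dist a b \<le> t" for a b
  proof -
    have "llmgf a + (b - a) \<bullet> gradient llmgf a \<le> llmgf b"
      using that N by (intro llmgf_above_tangent integrable_exp) auto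
    moreover have "- ((b - a) \<bullet> gradient llmgf a) \<le> norm (b - a) * norm (gradient llmgf a)"
      using Cauchy_Schwarz_ineq2[of "b - a" "gradient llmgf a"] by linarith
    moreover have "norm (b - a) * norm (gradient llmgf a) \<le> t * G"
      using that G[OF that(1)] by (intro mult_mono) (auto simp: dist_norm norm_minus_commute intro: order_trans[OF norm_ge_zero])
    ultimately show ?thesis by (simp add: mult.commute)
  qed
  have 2: "\<bar>llmgf y - llmgf x\<bar> \<le> G * t"
    using tangent[OF y xB x(2)] tangent[OF xB y d] by linarith
  show "\<bar>emp_log_mgf k X n \<omega> y - llmgf y\<bar> \<le> e * (1 + e) / n + (2 * K / r + G) * t"
    using 1 2 near[OF x(1)] unfolding f_def distrib_right by linarith
qed

section \<open>Almost sure uniform convergence\<close>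

theorem theorem2p5:
  fixes M :: "'w measure" and X :: "nat \<Rightarrow> 'w \<Rightarrow> real ^ 'n"
    and \<Lambda> :: "real ^ 'n \<Rightarrow> ereal"
    and D B B\<^sub>\<rho> :: "(real ^ 'n) set"
    and k :: "nat \<Rightarrow> nat" and \<epsilon> :: "nat \<Rightarrow> real" and \<rho> \<eta> :: real
  defines "\<Lambda> \<equiv> log_mgf M (X 1)"
    and "B\<^sub>\<rho> \<equiv> {\<theta>. infdist \<theta> B \<le> \<rho>}"
  assumes "prob_space M"
    and "prob_space.indep_vars M (\<lambda>_. borel) X {1..}"
    and "\<And>i. i \<ge> 1 \<Longrightarrow> distr M borel (X i) = distr M borel (X 1)"
    and "open D" and "convex D" and "\<And>\<theta>. \<theta> \<in> D \<Longrightarrow> \<Lambda> \<theta> < \<infinity>"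
    and "\<And>n. n \<ge> 1 \<Longrightarrow> k n > 0" and "mono_on {1..} k"
    and "compact B" and "B \<subseteq> D"
    and "\<rho> > 0" and "B\<^sub>\<rho> \<subseteq> D"
    and "\<And>n. n \<ge> 1 \<Longrightarrow> \<epsilon> n > 0" and "\<epsilon> \<longlonglongrightarrow> 0"
    and "(\<lambda>n. exp (- sqrt (\<epsilon> n) * (ln (real (k n)) - real n * real_of_ereal (Lambda_star_sup \<Lambda> B)))
              * \<epsilon> n powi (- (int CARD('n) + 1))
              * exp (real_of_ereal (xi2 \<Lambda> B\<^sub>\<rho>) * \<epsilon> n * real n)) summable_on {1..}"
    and "\<eta> > 0"
  shows "AE \<omega> in M. eventually (\<lambda>n. \<forall>\<theta>\<in>B.
           \<bar>emp_log_mgf k X n \<omega> \<theta> - real_of_ereal (\<Lambda> \<theta>)\<bar> \<le> error_bound \<Lambda> B \<epsilon> n \<eta>) sequentially"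
proof (cases "B = {}")
  case False
  note A = assms(3-)
  interpret prob_space M by (rule A(1))
  have X1: "random_variable borel (X 1)" using indep_vars_random_variable[OF A(2), of 1] by simp
  interpret iid_exponential_moments M X D
  proof unfold_locales
    show "random_variable borel (X 1)" "open D" "indep_vars (\<lambda>_. borel) X {1..}"
      by (rule X1 A(4) A(2))+
    show "distr M borel (X i) = distr M borel (X 1)" if "i \<ge> 1" for i using that by (rule A(3))
    fix \<theta> assume "\<theta> \<in> D"
    hence "\<Lambda> \<theta> < \<infinity>" by (rule A(6))
    thus "integrable M (\<lambda>\<omega>. exp (\<theta> \<bullet> X 1 \<omega>))" unfolding \<Lambda>_def log_mgf_def by (auto split: if_splits)
  qed
  have \<Lambda>: "real_of_ereal (\<Lambda> \<theta>) = llmgf \<theta>" for \<theta> by (simp add: \<Lambda>_def)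
  note B = A(9) A(10)
  have B\<rho>: "compact B\<^sub>\<rho>" unfolding B\<^sub>\<rho>_def by (rule compact_infdist_le[OF False B(1) A(11)])
  obtain R where R: "R > 0" "\<And>x. x \<in> B \<Longrightarrow> norm x \<le> R"
    using compact_imp_bounded[OF B(1)] unfolding bounded_pos by auto
  obtain F r where F: "finite F" "F \<subseteq> D" "r > 0" "\<And>x. x \<in> B \<Longrightarrow> cball x r \<subseteq> convex hull F"
    using compact_subset_open_imp_finite_hull[OF B(1) A(4) B(2)] by metis
  have "compact (llmgf ` B)" "compact (gradient llmgf ` B)"
    using B continuous_on_llmgf continuous_on_gradient_llmgf
    by (auto intro!: compact_continuous_image intro: continuous_on_subset)
  then obtain K1 G where K1: "\<And>x. x \<in> B \<Longrightarrow> norm (llmgf x) \<le> K1"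
      and G: "\<And>x. x \<in> B \<Longrightarrow> norm (gradient llmgf x) \<le> G"
    by (metis (mono_tags, lifting) bounded_iff compact_imp_bounded imageI)
  \<comment> \<open>One constant serves as upper bound near \<open>B\<close> and, with opposite sign, as lower
  bound on the net.\<close>
  define K where "K = Max (insert K1 (llmgf ` F)) + 1"
  have K: "llmgf v + 1 \<le> K" if "v \<in> F" for v using F(1) that by (auto simp: K_def)
  have K': "\<bar>llmgf x\<bar> + 1 \<le> K" if "x \<in> B" for x
  proof -
    have "K1 \<le> Max (insert K1 (llmgf ` F))" using F(1) by (intro Max_ge) auto
    thus ?thesis using K1[OF that] by (simp add: K_def)
  qed
  obtain x0 where x0: "x0 \<in> B" using False by blast
  define L where "L = 2 * K / r + G"
  have "K \<ge> 0" using K'[OF x0] by linarith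
  hence L: "L \<ge> 0" unfolding L_def using F(3) order_trans[OF norm_ge_zero G[OF x0]] by auto
  \<comment> \<open>The Lipschitz estimates lose \<open>L * \<delta> * \<epsilon> n\<close>, half of the
  allowed \<open>\<eta> * \<epsilon> n\<close>; \<open>L + 1\<close> avoids a division by zero.\<close>
  define \<delta> where "\<delta> = min (min 1 r) (\<eta> / (2 * (L + 1)))"
  have \<delta>: "\<delta> > 0" "\<delta> \<le> 1" "\<delta> \<le> r" using L A(16) F(3) by (auto simp: \<delta>_def)
  have L\<delta>: "L * \<delta> \<le> \<eta> / 2"
  proof -
    have "L * \<delta> \<le> (L + 1) * (\<eta> / (2 * (L + 1)))" using L A(16) \<delta> by (intro mult_mono) (auto simp: \<delta>_def)
    also have "\<dots> = \<eta> / 2" using L by (simp add: field_simps)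
    finally show ?thesis .
  qed
  obtain C where C: "C > 0" "\<And>t. 0 < t \<Longrightarrow> t \<le> 1 \<Longrightarrow> \<exists>N. finite N \<and> N \<subseteq> B
      \<and> (\<forall>x\<in>B. \<exists>y\<in>N. dist x y \<le> t) \<and> real (card N) \<le> C * inverse (t ^ CARD('n))"
    using bounded_imp_small_net[OF compact_imp_bounded[OF B(1)]] by metis
  \<comment> \<open>For these \<open>n\<close> the logarithm can be linearized and the rays
  \<open>(1 + u) *\<^sub>R x\<close> with \<open>u \<le> sqrt (\<epsilon> n)\<close> stay within
  distance \<open>\<rho>\<close> of \<open>B\<close>.\<close>
  define small where "small n \<longleftrightarrow> n \<ge> 1 \<and> \<epsilon> n \<le> 2 / 5 \<and> sqrt (\<epsilon> n) * R \<le> \<rho>" for n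
  have \<epsilon>: "\<epsilon> n > 0" "\<epsilon> n \<le> 2 / 5" "\<epsilon> n \<le> 1" "n \<ge> 1" "sqrt (\<epsilon> n) * R \<le> \<rho>" "k n > 0" if "small n" for n
    using that A(13)[of n] A(7)[of n] by (auto simp: small_def)
  have "\<exists>N. finite N \<and> N \<subseteq> B \<and> (\<forall>x\<in>B. \<exists>y\<in>N. dist x y \<le> \<delta> * \<epsilon> n)
      \<and> real (card N) \<le> C * inverse ((\<delta> * \<epsilon> n) ^ CARD('n))" if "small n" for n
    using \<epsilon>[OF that] \<delta> by (intro C(2)) (auto intro: mult_le_one)
  then obtain N where N: "\<And>n. small n \<Longrightarrow> finite (N n)" "\<And>n. small n \<Longrightarrow> N n \<subseteq> B"
     "\<And>n x. small n \<Longrightarrow> x \<in> B \<Longrightarrow> \<exists>y\<in>N n. dist x y \<le> \<delta> * \<epsilon> n"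
     "\<And>n. small n \<Longrightarrow> real (card (N n)) \<le> C * inverse ((\<delta> * \<epsilon> n) ^ CARD('n))"
    by metis
  \<comment> \<open>The general term of the given series without its power of \<open>\<epsilon> n\<close>; that
  power is made up in \<open>a\<close> of \<open>inverse (\<epsilon> n)\<close> from the deviation bound and
  the rest from the size of the net.\<close>
  define b where "b n = exp (- sqrt (\<epsilon> n) * (ln (real (k n)) - real n * real_of_ereal (Lambda_star_sup \<Lambda> B)))
              * exp (real_of_ereal (xi2 \<Lambda> B\<^sub>\<rho>) * \<epsilon> n * real n)" for n
  define a where "a n = (if n \<ge> 1 then b n * (inverse (\<epsilon> n) * inverse (\<epsilon> n ^ CARD('n))) else 0)" for n
  have b0: "b n \<ge> 0" for n by (simp add: b_def)
  have a0: "a n \<ge> 0" for n using b0 A(13)[of n] by (auto simp: a_def intro!: mult_nonneg_nonneg)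
  have sum_a: "summable a"
  proof (rule summable_on_imp_summable)
    have "\<epsilon> n powi (- (int CARD('n) + 1)) = inverse (\<epsilon> n) * inverse (\<epsilon> n ^ CARD('n))" if "n \<ge> 1" for n
    proof -
      have "\<epsilon> n powi (- (int CARD('n) + 1)) = \<epsilon> n powi (- int (Suc CARD('n)))" by (simp add: add.commute)
      also have "\<dots> = inverse (\<epsilon> n ^ Suc CARD('n))" by (subst power_int_minus) (simp only: power_int_of_nat)
      finally show ?thesis by simp
    qed
    hence "a n = exp (- sqrt (\<epsilon> n) * (ln (real (k n)) - real n * real_of_ereal (Lambda_star_sup \<Lambda> B)))
              * \<epsilon> n powi (- (int CARD('n) + 1))
              * exp (real_of_ereal (xi2 \<Lambda> B\<^sub>\<rho>) * \<epsilon> n * real n)" if "n \<ge> 1" for n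
      using that by (simp only: a_def b_def if_True mult_ac)
    thus "a summable_on UNIV"
      by (intro summable_on_cong_neutral[THEN iffD1, OF _ _ _ A(15)]) (auto simp: a_def)
  qed
  define badN where "badN n x = {\<omega>\<in>space M. \<bar>normalized_mean (k n) n x \<omega> - 1\<bar> > \<epsilon> n}" for n x
  define badF where "badF n v = {\<omega>\<in>space M. normalized_mean (k n) n v \<omega> \<ge> exp n}" for n v
  have badM: "badN n x \<in> events" "badF n x \<in> events" for n x unfolding badN_def badF_def by measurable
  \<comment> \<open>Empty for the initial indices, so that the estimate below holds for every
  \<open>n\<close>.\<close>
  define Bad where "Bad n = (if small n then (\<Union>x\<in>N n. badN n x) \<union> (\<Union>v\<in>F. badF n v) else {})" for n
  have BadM: "Bad n \<in> events" for n
    unfolding Bad_def using N(1) F(1) badM by (auto intro!: sets.Un sets.finite_UN)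
  define c where "c = 5 * exp 2 * C * inverse (\<delta> ^ CARD('n))"
  have prob_Bad: "prob (Bad n) \<le> c * a n + card F * exp (- real n)" for n
  proof (cases "small n")
    case True
    note e = \<epsilon>[OF True]
    have pN: "prob (badN n x) \<le> 5 * exp 2 * b n * inverse (\<epsilon> n)" if x: "x \<in> N n" for x
    proof -
      have xB: "x \<in> B" using x N(2)[OF True] by blast
      have ray: "(1 + u) *\<^sub>R x \<in> B\<^sub>\<rho>" if u: "0 \<le> u" "u \<le> sqrt (\<epsilon> n)" for u
      proof -
        have "dist ((1 + u) *\<^sub>R x) x = u * norm x" using u by (simp add: dist_norm algebra_simps)
        also have "\<dots> \<le> sqrt (\<epsilon> n) * R" using u R(2)[OF xB] e by (intro mult_mono) auto
        finally show ?thesis unfolding B\<^sub>\<rho>_def using e(5) xB by (auto intro: infdist_le2)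
      qed
      show ?thesis
        using prob_normalized_mean_deviation_uniform[OF B xB B\<rho> A(12) ray e(6) e(1) e(3)]
        unfolding badN_def b_def \<Lambda>_def by simp
    qed
    have pF: "prob (badF n v) \<le> exp (- real n)" if "v \<in> F" for v
      unfolding badF_def using that F(2) e(6) by (intro prob_normalized_mean_large) auto
    have "prob (Bad n) \<le> prob (\<Union>x\<in>N n. badN n x) + prob (\<Union>v\<in>F. badF n v)"
      using True badM N(1)[OF True] F(1) by (auto simp: Bad_def intro!: measure_Un_le sets.finite_UN)
    also have "\<dots> \<le> (\<Sum>x\<in>N n. prob (badN n x)) + (\<Sum>v\<in>F. prob (badF n v))"
      using badM N(1)[OF True] F(1) by (intro add_mono finite_measure_subadditive_finite) auto
    also have "\<dots> \<le> (\<Sum>x\<in>N n. 5 * exp 2 * b n * inverse (\<epsilon> n)) + (\<Sum>v\<in>F. exp (- real n))"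
      using pN pF by (intro add_mono sum_mono) auto
    also have "\<dots> = card (N n) * (5 * exp 2 * b n * inverse (\<epsilon> n)) + card F * exp (- real n)" by simp
    also have "card (N n) * (5 * exp 2 * b n * inverse (\<epsilon> n))
        \<le> (C * inverse ((\<delta> * \<epsilon> n) ^ CARD('n))) * (5 * exp 2 * b n * inverse (\<epsilon> n))"
      using b0[of n] e by (intro mult_right_mono N(4)[OF True]) auto
    also have "\<dots> = c * a n" using e by (simp add: c_def a_def power_mult_distrib mult_ac)
    finally show ?thesis by simp
  next
    case False
    have "0 \<le> c" using C \<delta> by (simp add: c_def)
    thus ?thesis using False a0[of n] by (simp add: Bad_def)
  qed
  have "summable (\<lambda>n. prob (Bad n))"
  proof (rule summable_comparison_test')
    have "summable (\<lambda>n. exp (-1 :: real) ^ n)" by (rule summable_geometric) simp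
    hence "summable (\<lambda>n. exp (- real n))" by (simp flip: exp_of_nat_mult)
    thus "summable (\<lambda>n. c * a n + card F * exp (- real n))" using sum_a by (intro summable_add summable_mult)
    show "norm (prob (Bad n)) \<le> c * a n + card F * exp (- real n)" if "n \<ge> 0" for n using prob_Bad by simp
  qed
  hence "AE \<omega> in M. eventually (\<lambda>n. \<omega> \<in> space M - Bad n) sequentially"
    using BadM by (intro borel_cantelli_AE1) (auto simp: emeasure_eq_measure)
  \<comment> \<open>The second condition leaves the other half of \<open>\<eta> * \<epsilon> n\<close> to the
  error \<open>\<epsilon> n * (1 + \<epsilon> n) / n\<close> at the net points.\<close>
  moreover have "eventually (\<lambda>n. small n \<and> 4 / \<eta> \<le> real n) sequentially"
  proof -
    have "(\<lambda>n. sqrt (\<epsilon> n) * R) \<longlonglongrightarrow> sqrt 0 * R" by (intro tendsto_intros A(14))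
    hence "eventually (\<lambda>n. sqrt (\<epsilon> n) * R < \<rho>) sequentially" using A(11) by (auto dest: order_tendstoD(2))
    moreover have "eventually (\<lambda>n. \<epsilon> n < 2 / 5) sequentially" by (rule order_tendstoD(2)[OF A(14)]) simp
    moreover have "eventually (\<lambda>n. 4 / \<eta> \<le> real n) sequentially"
      using filterlim_real_sequentially unfolding filterlim_at_top by blast
    moreover have "eventually (\<lambda>n. n \<ge> (1::nat)) sequentially" by (rule eventually_ge_at_top)
    ultimately show ?thesis by eventually_elim (auto simp: small_def)
  qed
  ultimately show ?thesis
  proof (elim AE_mp, intro AE_I2 impI)
    fix \<omega> assume "\<omega> \<in> space M" and ev: "eventually (\<lambda>n. \<omega> \<in> space M - Bad n) sequentially"
      and sm: "eventually (\<lambda>n. small n \<and> 4 / \<eta> \<le> real n) sequentially"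
    show "eventually (\<lambda>n. \<forall>\<theta>\<in>B.
           \<bar>emp_log_mgf k X n \<omega> \<theta> - real_of_ereal (\<Lambda> \<theta>)\<bar> \<le> error_bound \<Lambda> B \<epsilon> n \<eta>) sequentially"
      using ev sm
    proof eventually_elim
      case (elim n)
      have sml: "small n" and n\<eta>: "4 / \<eta> \<le> real n" using elim by auto
      note e = \<epsilon>[OF sml]
      have good: "\<And>x. x \<in> N n \<Longrightarrow> \<bar>normalized_mean (k n) n x \<omega> - 1\<bar> \<le> \<epsilon> n"
        "\<And>v. v \<in> F \<Longrightarrow> normalized_mean (k n) n v \<omega> \<le> exp n"
        using elim sml unfolding Bad_def badN_def badF_def by (auto simp: not_less not_le less_imp_le)
      have "\<delta> * \<epsilon> n \<le> r * 1" using \<delta> e by (intro mult_mono) auto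
      hence tr: "\<delta> * \<epsilon> n \<le> r" by simp
      note close = emp_log_mgf_uniformly_close[where k = k and n = n,
          OF e(4) e(6) e(1) e(2) tr F(3) N(2)[OF sml] N(3)[OF sml] B(2) F(2) F(4) K K' G good]
      have closeN: "\<bar>emp_log_mgf k X n \<omega> x - llmgf x\<bar> \<le> \<epsilon> n * (1 + \<epsilon> n) / n" if "x \<in> N n" for x
        using close(1) that by blast
      have closeB: "\<bar>emp_log_mgf k X n \<omega> y - llmgf y\<bar> \<le> \<epsilon> n * (1 + \<epsilon> n) / n + L * (\<delta> * \<epsilon> n)"
        if "y \<in> B" for y
        unfolding L_def using close(2) that by blast
      show ?case
      proof
        fix \<theta> assume \<theta>: "\<theta> \<in> B"
        show "\<bar>emp_log_mgf k X n \<omega> \<theta> - real_of_ereal (\<Lambda> \<theta>)\<bar> \<le> error_bound \<Lambda> B \<epsilon> n \<eta>"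
        proof (cases "is_singleton B")
          case True
          \<comment> \<open>A nonempty net inside a single point is that point.\<close>
          then have "B = {\<theta>}" using \<theta> by (metis is_singleton_def singletonD)
          hence "\<theta> \<in> N n" using N(2)[OF sml] N(3)[OF sml \<theta>] by auto
          thus ?thesis using closeN True unfolding \<Lambda> by (simp add: error_bound_def)
        next
          case False
          have "0 \<le> xi1 \<Lambda> B" unfolding xi1_def using x0 by (intro SUP_upper2[OF x0]) auto
          hence xi: "0 \<le> real_of_ereal (xi1 \<Lambda> B)" by (rule real_of_ereal_pos)
          have "\<epsilon> n * (1 + \<epsilon> n) / n \<le> \<eta> / 2 * \<epsilon> n"
          proof -
            have "1 + \<epsilon> n \<le> \<eta> / 2 * n" using n\<eta> A(16) e by (simp add: field_simps)
            hence "\<epsilon> n * (1 + \<epsilon> n) \<le> \<epsilon> n * (\<eta> / 2 * n)" using e by (intro mult_left_mono) auto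
            thus ?thesis using e by (simp add: field_simps)
          qed
          moreover have "L * (\<delta> * \<epsilon> n) \<le> \<eta> / 2 * \<epsilon> n"
            using mult_right_mono[OF L\<delta>, of "\<epsilon> n"] e by (simp add: mult_ac)
          moreover have "0 \<le> 2 * real_of_ereal (xi1 \<Lambda> B) * \<epsilon> n" using xi e by simp
          ultimately have "\<epsilon> n * (1 + \<epsilon> n) / n + L * (\<delta> * \<epsilon> n) \<le> (\<eta> + 2 * real_of_ereal (xi1 \<Lambda> B)) * \<epsilon> n"
            unfolding distrib_right by linarith
          thus ?thesis using closeB[OF \<theta>] False unfolding \<Lambda> by (simp add: error_bound_def)
        qed
      qed
    qed
  qed
qed simp

end
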